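(* Let $\mathcal F$ be a unital $C^*$-algebra and let $\mathfrak S_0\subsetneq\mathfrak S(\mathcal F)$ be a folium. For each $\omega\in\mathfrak S_0$ let $\mathcal C_\omega$ be a maximally commutative von Neumann subalgebra of $\pi_\omega(\mathcal F)'$, with associated measure space $(X_\omega,\mu_\omega)$, and let $(X,\mu)$ be the disjoint union of the measure spaces $(X_\omega,\mu_\omega)$, $\omega\in\mathfrak S_0$. If $(\mathcal F,\mathfrak S_0)$ has an ideal host, then $\mu$ must have discrete points.
   Context: $\mathfrak S(\cdot)$ denotes the state space of a $C^*$-algebra. A folium (in the state space) is a norm-closed convex set $\mathfrak S_0\subset\mathfrak S(\mathcal F)$ such that if $\omega\in\mathfrak S_0$ and $B\in\mathcal F$ with $\omega(B^*B)=1$, then the state $F\mapsto\omega(B^*FB)$ is in $\mathfrak S_0$. An ideal host for $(\mathcal F,\mathfrak S_0)$ is a $C^*$-algebra $\mathcal L$ for which there are a unital $C^*$-algebra $\mathcal E$ containing $\mathcal L$ as a closed two-sided ideal and a unital $*$-homomorphism $\xi:\mathcal F\to\mathcal E$ such that $\mathcal E$ is generated by $\mathcal L$ and $\xi(\mathcal F)$ and the map $\theta:\mathfrak S(\mathcal L)\to\mathfrak S(\mathcal F)$, $\theta(\omega)(F)=\lim_\alpha\omega(E_\alpha\xi(F)E_\alpha)$ ($\{E_\alpha\}$ any approximate identity of $\mathcal L$) is injective with range $\mathfrak S_0$. For $\omega\in\mathfrak S_0$ with GNS representation $(\pi_\omega,\mathcal H_\omega,\Omega_\omega)$, $X_\omega$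 is the spectrum of the commutative von Neumann algebra $\mathcal C_\omega$, and $\mu_\omega$ is the probability measure on $X_\omega$ with $(\Omega_\omega,C\,\Omega_\omega)=\int_{X_\omega}\Phi(C)\,d\mu_\omega$ for $C\in\mathcal C_\omega$, where $\Phi:\mathcal C_\omega\to C(X_\omega)$ is the Gel'fand isomorphism; then $\mathcal C_\omega\cong L^\infty(X_\omega,\mu_\omega)$. A discrete point of $\mu$ is a point $x$ with $\mu(\{x\})>0$. *)

theory Defs
  imports "HOL-Probability.Probability"
begin

section \<open>Unital C*-algebras and complex Hilbert spaces\<close>

class complex_normed_vector = real_normed_vector +
  fixes scaleC :: "complex \<Rightarrow> 'a \<Rightarrow> 'a"  (infixr "*\<^sub>C" 75)
  assumes scaleC_of_real: "of_real r *\<^sub>C x = r *\<^sub>R x"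
    and scaleC_add_right: "c *\<^sub>C (x + y) = c *\<^sub>C x + c *\<^sub>C y"
    and scaleC_add_left: "(c + d) *\<^sub>C x = c *\<^sub>C x + d *\<^sub>C x"
    and scaleC_scaleC: "c *\<^sub>C d *\<^sub>C x = (c * d) *\<^sub>C x"
    and norm_scaleC: "norm (c *\<^sub>C x) = cmod c * norm x"

text \<open>The zero algebra is excluded, since \<open>real_normed_algebra_1\<close> has \<open>0 \<noteq> 1\<close>;
  it has no states.\<close>

class cstar_algebra_1 = complex_normed_vector + real_normed_algebra_1 + banach +
  fixes star :: "'a \<Rightarrow> 'a"
  assumes mult_scaleC_left: "(c *\<^sub>C a) * b = c *\<^sub>C (a * b)"
    and mult_scaleC_right: "a * (c *\<^sub>C b) = c *\<^sub>C (a * b)"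
    and star_add: "star (a + b) = star a + star b"
    and star_scaleC: "star (c *\<^sub>C a) = cnj c *\<^sub>C star a"
    and star_mult: "star (a * b) = star b * star a"
    and star_star: "star (star a) = a"
    and cstar_identity: "norm (star a * a) = (norm a)\<^sup>2"

text \<open>The inner product is linear in the second argument.\<close>

class chilbert_space = complex_normed_vector + banach +
  fixes cinner :: "'a \<Rightarrow> 'a \<Rightarrow> complex"
  assumes cinner_commute: "cinner x y = cnj (cinner y x)"
    and cinner_add_right: "cinner x (y + z) = cinner x y + cinner x z"
    and cinner_scaleC_right: "cinner x (c *\<^sub>C y) = c * cinner x y"
    and cinner_same: "cinner x x = of_real ((norm x)\<^sup>2)"

definition complex_subspace :: "'a::complex_normed_vector set \<Rightarrow> bool" where
  "complex_subspace S \<longleftrightarrow>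
     0 \<in> S \<and> (\<forall>x\<in>S. \<forall>y\<in>S. x + y \<in> S) \<and> (\<forall>c. \<forall>x\<in>S. c *\<^sub>C x \<in> S)"

definition cstar_subalgebra :: "'a::cstar_algebra_1 set \<Rightarrow> bool" where
  "cstar_subalgebra A \<longleftrightarrow>
     complex_subspace A \<and> closed A \<and> (\<forall>a\<in>A. \<forall>b\<in>A. a * b \<in> A) \<and> (\<forall>a\<in>A. star a \<in> A)"

definition closed_two_sided_ideal :: "'a::cstar_algebra_1 set \<Rightarrow> bool" where
  "closed_two_sided_ideal L \<longleftrightarrow>
     complex_subspace L \<and> closed L \<and> (\<forall>a\<in>L. \<forall>x. x * a \<in> L \<and> a * x \<in> L)"

definition unital_star_hom :: "('a::cstar_algebra_1 \<Rightarrow> 'b::cstar_algebra_1) \<Rightarrow> bool" where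
  "unital_star_hom \<xi> \<longleftrightarrow>
     (\<forall>a b. \<xi> (a + b) = \<xi> a + \<xi> b) \<and> (\<forall>c a. \<xi> (c *\<^sub>C a) = c *\<^sub>C \<xi> a) \<and>
     (\<forall>a b. \<xi> (a * b) = \<xi> a * \<xi> b) \<and> (\<forall>a. \<xi> (star a) = star (\<xi> a)) \<and> \<xi> 1 = 1"


section \<open>States and folia\<close>

text \<open>A C*-algebra without unit is represented as a C*-subalgebra \<open>A\<close> of a unital one.
  Functionals on \<open>A\<close> are made unique as HOL functions by requiring them to be \<open>undefined\<close>
  outside \<open>A\<close>; for \<open>A = UNIV\<close> this is no restriction.\<close>

definition functional_norm :: "'a::complex_normed_vector set \<Rightarrow> ('a \<Rightarrow> complex) \<Rightarrow> real" where
  "functional_norm A \<phi> = (SUP a\<in>{a \<in> A. norm a \<le> 1}. cmod (\<phi> a))"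

definition dual_space :: "'a::complex_normed_vector set \<Rightarrow> ('a \<Rightarrow> complex) set" where
  "dual_space A = {\<phi> \<in> extensional A.
     (\<forall>a\<in>A. \<forall>b\<in>A. \<phi> (a + b) = \<phi> a + \<phi> b) \<and>
     (\<forall>c. \<forall>a\<in>A. \<phi> (c *\<^sub>C a) = c * \<phi> a) \<and>
     (\<exists>K. \<forall>a\<in>A. cmod (\<phi> a) \<le> K * norm a)}"

definition state_space :: "'a::cstar_algebra_1 set \<Rightarrow> ('a \<Rightarrow> complex) set" where
  "state_space A = {\<omega> \<in> dual_space A.
     (\<forall>a\<in>A. \<omega> (star a * a) \<in> \<real>\<^sub>\<ge>\<^sub>0) \<and> functional_norm A \<omega> = 1}"

text \<open>Folia are nonempty by convention: the empty set would be the folium with ideal host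
  \<open>{0}\<close>.\<close>

definition folium :: "('a::cstar_algebra_1 \<Rightarrow> complex) set \<Rightarrow> bool" where
  "folium S \<longleftrightarrow>
     S \<noteq> {} \<and> S \<subseteq> state_space UNIV \<and>
     (\<forall>\<phi>\<in>dual_space UNIV.
        (\<forall>\<epsilon>>0. \<exists>\<psi>\<in>S. functional_norm UNIV (\<lambda>a. \<phi> a - \<psi> a) < \<epsilon>) \<longrightarrow> \<phi> \<in> S) \<and>
     (\<forall>\<phi>\<in>S. \<forall>\<psi>\<in>S. \<forall>t\<in>{0..1::real}.
        (\<lambda>a. of_real t * \<phi> a + of_real (1 - t) * \<psi> a) \<in> S) \<and>
     (\<forall>\<omega>\<in>S. \<forall>b. \<omega> (star b * b) = 1 \<longrightarrow> (\<lambda>a. \<omega> (star b * a * b)) \<in> S)"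


section \<open>Ideal hosts\<close>

text \<open>A net in \<open>L\<close> enters only through the filter it generates on the ambient algebra, and
  every proper filter arises from a net.  So approximate identities are represented by
  filters.\<close>

definition approximate_identity :: "'a::cstar_algebra_1 set \<Rightarrow> 'a filter \<Rightarrow> bool" where
  "approximate_identity L G \<longleftrightarrow>
     G \<noteq> bot \<and>
     (\<forall>\<^sub>F e in G. e \<in> L \<and> (\<exists>a\<in>L. e = star a * a) \<and> norm e \<le> 1) \<and>
     (\<forall>a\<in>L. ((\<lambda>e. e * a) \<longlongrightarrow> a) G \<and> ((\<lambda>e. a * e) \<longlongrightarrow> a) G)"

definition host_map ::
  "'e::cstar_algebra_1 set \<Rightarrow> ('f \<Rightarrow> 'e) \<Rightarrow> ('e \<Rightarrow> complex) \<Rightarrow> 'f \<Rightarrow> complex" where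
  "host_map L \<xi> \<omega> = (\<lambda>a. THE z. \<forall>G. approximate_identity L G \<longrightarrow>
     ((\<lambda>e. \<omega> (e * \<xi> a * e)) \<longlongrightarrow> z) G)"

text \<open>The unital algebra containing \<open>L\<close> is the whole type \<open>'e\<close>.\<close>

definition ideal_host ::
  "'e::cstar_algebra_1 set \<Rightarrow> ('f::cstar_algebra_1 \<Rightarrow> complex) set \<Rightarrow> bool" where
  "ideal_host L S \<longleftrightarrow>
     cstar_subalgebra L \<and> closed_two_sided_ideal L \<and>
     (\<exists>\<xi>::'f \<Rightarrow> 'e. unital_star_hom \<xi> \<and>
        cstar_subalgebra hull (L \<union> range \<xi>) = UNIV \<and>
        inj_on (host_map L \<xi>) (state_space L) \<and>
        host_map L \<xi> ` state_space L = S)"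


section \<open>Operators on a closed subspace and GNS representations\<close>

text \<open>All Hilbert spaces of a family are closed subspaces \<open>H\<close> of one ambient Hilbert space
  type, for instance of their direct sum.  An operator on \<open>H\<close> is \<open>undefined\<close>
  outside \<open>H\<close>.\<close>

definition bounded_operators :: "'h::chilbert_space set \<Rightarrow> ('h \<Rightarrow> 'h) set" where
  "bounded_operators H = {T \<in> H \<rightarrow>\<^sub>E H.
     (\<forall>x\<in>H. \<forall>y\<in>H. T (x + y) = T x + T y) \<and>
     (\<forall>c. \<forall>x\<in>H. T (c *\<^sub>C x) = c *\<^sub>C T x) \<and>
     (\<exists>K. \<forall>x\<in>H. norm (T x) \<le> K * norm x)}"

definition adjoint_on :: "'h::chilbert_space set \<Rightarrow> ('h \<Rightarrow> 'h) \<Rightarrow> ('h \<Rightarrow> 'h) \<Rightarrow> bool" where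
  "adjoint_on H T S \<longleftrightarrow> (\<forall>x\<in>H. \<forall>y\<in>H. cinner (S x) y = cinner x (T y))"

definition star_representation ::
  "'h::chilbert_space set \<Rightarrow> ('f::cstar_algebra_1 \<Rightarrow> 'h \<Rightarrow> 'h) \<Rightarrow> bool" where
  "star_representation H \<pi> \<longleftrightarrow>
     (\<forall>a. \<pi> a \<in> bounded_operators H) \<and>
     (\<forall>a b. \<forall>x\<in>H. \<pi> (a + b) x = \<pi> a x + \<pi> b x) \<and>
     (\<forall>c a. \<forall>x\<in>H. \<pi> (c *\<^sub>C a) x = c *\<^sub>C \<pi> a x) \<and>
     (\<forall>a b. \<forall>x\<in>H. \<pi> (a * b) x = \<pi> a (\<pi> b x)) \<and>
     (\<forall>a. adjoint_on H (\<pi> a) (\<pi> (star a)))"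

definition gns_representation ::
  "('f::cstar_algebra_1 \<Rightarrow> complex) \<Rightarrow> 'h::chilbert_space set \<Rightarrow> ('f \<Rightarrow> 'h \<Rightarrow> 'h) \<Rightarrow> 'h \<Rightarrow> bool"
  where
  "gns_representation \<omega> H \<pi> \<Omega> \<longleftrightarrow>
     complex_subspace H \<and> closed H \<and> star_representation H \<pi> \<and>
     \<Omega> \<in> H \<and> closure (range (\<lambda>a. \<pi> a \<Omega>)) = H \<and> (\<forall>a. \<omega> a = cinner \<Omega> (\<pi> a \<Omega>))"

definition commutant :: "'h::chilbert_space set \<Rightarrow> ('h \<Rightarrow> 'h) set \<Rightarrow> ('h \<Rightarrow> 'h) set" where
  "commutant H M = {T \<in> bounded_operators H. \<forall>S\<in>M. \<forall>x\<in>H. T (S x) = S (T x)}"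

definition von_neumann_algebra :: "'h::chilbert_space set \<Rightarrow> ('h \<Rightarrow> 'h) set \<Rightarrow> bool" where
  "von_neumann_algebra H M \<longleftrightarrow>
     M \<subseteq> bounded_operators H \<and> (\<forall>T\<in>M. \<exists>S\<in>M. adjoint_on H T S) \<and>
     commutant H (commutant H M) = M"

definition commuting_operators :: "'h set \<Rightarrow> ('h \<Rightarrow> 'h) set \<Rightarrow> bool" where
  "commuting_operators H M \<longleftrightarrow> (\<forall>S\<in>M. \<forall>T\<in>M. \<forall>x\<in>H. S (T x) = T (S x))"

definition maximally_commutative_subalgebra ::
  "'h::chilbert_space set \<Rightarrow> ('h \<Rightarrow> 'h) set \<Rightarrow> ('h \<Rightarrow> 'h) set \<Rightarrow> bool" where
  "maximally_commutative_subalgebra H N C \<longleftrightarrow>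
     von_neumann_algebra H C \<and> C \<subseteq> N \<and> commuting_operators H C \<and>
     (\<forall>D. von_neumann_algebra H D \<and> D \<subseteq> N \<and> commuting_operators H D \<and> C \<subseteq> D \<longrightarrow> D = C)"


section \<open>Spectra and their measures\<close>

definition gelfand_spectrum ::
  "'h::chilbert_space set \<Rightarrow> ('h \<Rightarrow> 'h) set \<Rightarrow> (('h \<Rightarrow> 'h) \<Rightarrow> complex) set" where
  "gelfand_spectrum H C = {\<psi> \<in> extensional C.
     (\<forall>S\<in>C. \<forall>T\<in>C. \<psi> (\<lambda>x\<in>H. S x + T x) = \<psi> S + \<psi> T) \<and>
     (\<forall>c. \<forall>T\<in>C. \<psi> (\<lambda>x\<in>H. c *\<^sub>C T x) = c * \<psi> T) \<and>
     (\<forall>S\<in>C. \<forall>T\<in>C. \<psi> (\<lambda>x\<in>H. S (T x)) = \<psi> S * \<psi> T) \<and>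
     (\<exists>T\<in>C. \<psi> T \<noteq> 0)}"

definition gelfand_topology ::
  "'h::chilbert_space set \<Rightarrow> ('h \<Rightarrow> 'h) set \<Rightarrow> (('h \<Rightarrow> 'h) \<Rightarrow> complex) topology" where
  "gelfand_topology H C =
     subtopology (product_topology (\<lambda>_. euclidean) C) (gelfand_spectrum H C)"

definition gelfand_transform :: "('h \<Rightarrow> 'h) \<Rightarrow> (('h \<Rightarrow> 'h) \<Rightarrow> complex) \<Rightarrow> complex" where
  "gelfand_transform T = (\<lambda>\<psi>. \<psi> T)"

text \<open>Inner regularity makes the measure unique (Riesz representation theorem).\<close>

definition gelfand_measure ::
  "'h::chilbert_space set \<Rightarrow> ('h \<Rightarrow> 'h) set \<Rightarrow> 'h \<Rightarrow> (('h \<Rightarrow> 'h) \<Rightarrow> complex) measure \<Rightarrow> bool"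
  where
  "gelfand_measure H C \<Omega> M \<longleftrightarrow>
     space M = gelfand_spectrum H C \<and>
     sets M = sigma_sets (gelfand_spectrum H C) {U. openin (gelfand_topology H C) U} \<and>
     prob_space M \<and>
     (\<forall>A\<in>sets M. emeasure M A =
        (SUP K\<in>{K. compactin (gelfand_topology H C) K \<and> K \<subseteq> A}. emeasure M K)) \<and>
     (\<forall>T\<in>C. cinner \<Omega> (T \<Omega>) = (\<integral>\<psi>. gelfand_transform T \<psi> \<partial>M))"

definition disjoint_union_measure :: "'i set \<Rightarrow> ('i \<Rightarrow> 'a measure) \<Rightarrow> ('i \<times> 'a) measure" where
  "disjoint_union_measure I M =
     measure_of (SIGMA i:I. space (M i))
       {A. A \<subseteq> (SIGMA i:I. space (M i)) \<and> (\<forall>i\<in>I. Pair i -` A \<in> sets (M i))}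
       (\<lambda>A. \<integral>\<^sup>+i. emeasure (M i) (Pair i -` A) \<partial>count_space I)"

definition discrete_points :: "'a measure \<Rightarrow> 'a set" where
  "discrete_points M = {x \<in> space M. emeasure M {x} > 0}"

lemma sigma_algebra_disjoint_union:
  "sigma_algebra (SIGMA i:I. space (M i))
     {A. A \<subseteq> (SIGMA i:I. space (M i)) \<and> (\<forall>i\<in>I. Pair i -` A \<in> sets (M i))}"
  (is "sigma_algebra ?X ?S")
proof (rule sigma_algebra_iff2[THEN iffD2], intro conjI ballI allI impI)
  show "?S \<subseteq> Pow ?X" by auto
  show "{} \<in> ?S" by auto
next
  fix A assume A: "A \<in> ?S"
  have "Pair i -` (?X - A) = space (M i) - Pair i -` A" if "i \<in> I" for i
    using that by auto
  then show "?X - A \<in> ?S" using A by auto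
next
  fix A :: "nat \<Rightarrow> _" assume A: "range A \<subseteq> ?S"
  have "Pair i -` (\<Union>n. A n) \<in> sets (M i)" if "i \<in> I" for i
  proof -
    have "Pair i -` (\<Union>n. A n) = (\<Union>n. Pair i -` A n)" by auto
    also have "\<dots> \<in> sets (M i)" using A that by (intro sets.countable_UN) auto
    finally show ?thesis .
  qed
  then show "(\<Union>n. A n) \<in> ?S" using A by auto
qed

lemma space_disjoint_union_measure:
  "space (disjoint_union_measure I M) = (SIGMA i:I. space (M i))"
  unfolding disjoint_union_measure_def by (rule space_measure_of) auto

lemma sets_disjoint_union_measure:
  "sets (disjoint_union_measure I M) =
     {A. A \<subseteq> (SIGMA i:I. space (M i)) \<and> (\<forall>i\<in>I. Pair i -` A \<in> sets (M i))}"
  unfolding disjoint_union_measure_def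
  by (rule sigma_algebra.sets_measure_of_eq[OF sigma_algebra_disjoint_union])

lemma emeasure_disjoint_union_measure:
  assumes A: "A \<in> sets (disjoint_union_measure I M)"
  shows "emeasure (disjoint_union_measure I M) A =
           (\<integral>\<^sup>+i. emeasure (M i) (Pair i -` A) \<partial>count_space I)"
proof (rule emeasure_measure_of[OF disjoint_union_measure_def _ _ _ A])
  show "positive (sets (disjoint_union_measure I M))
          (\<lambda>A. \<integral>\<^sup>+i. emeasure (M i) (Pair i -` A) \<partial>count_space I)"
    by (simp add: positive_def)
  show "countably_additive (sets (disjoint_union_measure I M))
          (\<lambda>A. \<integral>\<^sup>+i. emeasure (M i) (Pair i -` A) \<partial>count_space I)"
  proof (rule countably_additiveI)
    fix A :: "nat \<Rightarrow> _"
    assume A: "range A \<subseteq> sets (disjoint_union_measure I M)" "disjoint_family A"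
    have "(\<Sum>n. \<integral>\<^sup>+i. emeasure (M i) (Pair i -` A n) \<partial>count_space I) =
          (\<integral>\<^sup>+i. (\<Sum>n. emeasure (M i) (Pair i -` A n)) \<partial>count_space I)"
      by (rule nn_integral_suminf[symmetric]) simp
    also have "\<dots> = (\<integral>\<^sup>+i. emeasure (M i) (Pair i -` (\<Union>n. A n)) \<partial>count_space I)"
    proof (rule nn_integral_cong)
      fix i assume "i \<in> space (count_space I)"
      then have "range (\<lambda>n. Pair i -` A n) \<subseteq> sets (M i)"
        using A(1) by (auto simp: sets_disjoint_union_measure)
      moreover have "disjoint_family (\<lambda>n. Pair i -` A n)"
        using A(2) by (auto simp: disjoint_family_on_def)
      ultimately have "(\<Sum>n. emeasure (M i) (Pair i -` A n)) =
          emeasure (M i) (\<Union>n. Pair i -` A n)"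
        by (rule suminf_emeasure)
      then show "(\<Sum>n. emeasure (M i) (Pair i -` A n)) = emeasure (M i) (Pair i -` (\<Union>n. A n))"
        by (simp add: vimage_UN)
    qed
    finally show "(\<Sum>n. \<integral>\<^sup>+i. emeasure (M i) (Pair i -` A n) \<partial>count_space I) =
       (\<integral>\<^sup>+i. emeasure (M i) (Pair i -` (\<Union>n. A n)) \<partial>count_space I)" .
  qed
qed auto

end

theory Submission
  imports Defs
begin

text \<open>
  The positive functionals of norm at most one on the host \<open>L\<close> form a compact convex set, so \<open>L\<close>
  has a pure state \<open>\<rho>\<close>. As \<open>\<theta>\<close> is affine and injective with range \<open>S\<^sub>0\<close>, the state
  \<open>\<omega> = \<theta> \<rho>\<close> is extremal in \<open>S\<^sub>0\<close>. A folium contains all vector states of the GNS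
  representation of \<open>\<omega>\<close>. For a selfadjoint \<open>A\<close> of small norm in the commutant, the vectors
  \<open>A \<Omega>\<close> and \<open>sqrt (1 - A\<^sup>2) \<Omega>\<close> therefore decompose \<open>\<omega>\<close> inside the cone over \<open>S\<^sub>0\<close>.
  Extremality forces \<open>A\<^sup>2\<close> to be scalar. Hence the commutant, and with it the commutative
  algebra, consists of scalars, and its spectrum is a single point of mass one.
\<close>

section \<open>Extremal points of compact sets of functionals\<close>

text \<open>\<open>L\<close> may lack a unit, and this shapes the first half. Norm one can be lost
  under pointwise limits, so compactness is sought among all positive contractive functionals; the
  price is the extremal point 0, which has to be avoided. The value at 1 is replaced by elements of
  the unit ball on which a state is nearly 1, and affinity of \<theta>, like the fact that mixtures
  of states keep norm one, rests on an approximate identity. In the second half spectral theory is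
  avoided. Only the single vector \<open>sqrt (1 - A\<^sup>2) \<Omega>\<close> is wanted, so an
  iteration of polynomials in \<open>A\<close> is evaluated at \<Omega> and the limit operator is
  never formed. The bound 1/2 on \<open>A\<close> makes this iteration converge geometrically and
  keeps the square of \<open>norm (A \<Omega>)\<close> below 1. The passage from scalar squares to
  scalar operators uses the squares of an operator and of its translate instead of spectral
  projections. Contractivity of \<pi>, which turns closeness of vectors into closeness of
  functionals, is drawn from the folium condition.\<close>

definition mix :: "real \<Rightarrow> ('a \<Rightarrow> complex) \<Rightarrow> ('a \<Rightarrow> complex) \<Rightarrow> 'a \<Rightarrow> complex" where
  "mix t \<phi> \<psi> = (\<lambda>a. of_real t * \<phi> a + of_real (1 - t) * \<psi> a)"

definition extremal_in :: "('a \<Rightarrow> complex) set \<Rightarrow> ('a \<Rightarrow> complex) \<Rightarrow> bool" where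
  "extremal_in K \<rho> \<longleftrightarrow> \<rho> \<in> K \<and>
     (\<forall>\<phi>\<in>K. \<forall>\<psi>\<in>K. \<forall>t\<in>{0<..<1}. \<rho> = mix t \<phi> \<psi> \<longrightarrow> \<phi> = \<rho> \<and> \<psi> = \<rho>)"

definition closed_face :: "('a \<Rightarrow> complex) set \<Rightarrow> ('a \<Rightarrow> complex) set \<Rightarrow> bool" where
  "closed_face K F \<longleftrightarrow> F \<noteq> {} \<and> closedin (top_of_set K) F \<and>
     (\<forall>\<phi>\<in>K. \<forall>\<psi>\<in>K. \<forall>t\<in>{0<..<1}. mix t \<phi> \<psi> \<in> F \<longrightarrow> \<phi> \<in> F \<and> \<psi> \<in> F)"

lemma closed_faceI:
  assumes "F \<noteq> {}" "closedin (top_of_set K) F"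
    and "\<And>\<phi> \<psi> t. \<phi> \<in> K \<Longrightarrow> \<psi> \<in> K \<Longrightarrow> t \<in> {0<..<1} \<Longrightarrow> mix t \<phi> \<psi> \<in> F \<Longrightarrow> \<phi> \<in> F \<and> \<psi> \<in> F"
  shows "closed_face K F"
  using assms unfolding closed_face_def by simp

lemma closed_faceD:
  assumes "closed_face K F" "\<phi> \<in> K" "\<psi> \<in> K" "t \<in> {0<..<1}" "mix t \<phi> \<psi> \<in> F"
  shows "\<phi> \<in> F" "\<psi> \<in> F"
  using assms unfolding closed_face_def by fast+

text \<open>An affine function takes at a mixture the weighted mean of its values at the ends. If
  the mean equals the maximum, two nonnegative gaps with positive weights sum to 0, so both ends
  attain the maximum.\<close>

lemma closed_face_argmax:
  fixes h :: "('a \<Rightarrow> complex) \<Rightarrow> real"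
  assumes "compact K" "closed_face K F" "continuous_on K h"
    and affine: "\<And>t \<phi> \<psi>. h (mix t \<phi> \<psi>) = t * h \<phi> + (1 - t) * h \<psi>"
  shows "\<exists>m. closed_face K {\<phi>\<in>F. h \<phi> = m} \<and> (\<forall>\<phi>\<in>F. h \<phi> \<le> m)"
proof -
  have F: "F \<noteq> {}" "closedin (top_of_set K) F" "F \<subseteq> K"
    using assms(2) closedin_imp_subset unfolding closed_face_def by blast+
  have "compact F" using assms(1) F(2) by (rule closedin_compact)
  moreover have "continuous_on F h" using assms(3) F(3) by (rule continuous_on_subset)
  ultimately obtain x where x: "x \<in> F" "\<And>y. y \<in> F \<Longrightarrow> h y \<le> h x"
    using continuous_attains_sup[of F h] F(1) by auto
  let ?G = "{\<phi>\<in>F. h \<phi> = h x}"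
  have "closedin (top_of_set K) (F \<inter> (K \<inter> h -` {h x}))"
    using F(2) continuous_closedin_preimage[OF assms(3) closed_singleton] by (rule closedin_Int)
  moreover have "F \<inter> (K \<inter> h -` {h x}) = ?G" using F(3) by auto
  ultimately have "closedin (top_of_set K) ?G" by simp
  moreover have "\<phi> \<in> ?G \<and> \<psi> \<in> ?G"
    if \<phi>: "\<phi> \<in> K" and \<psi>: "\<psi> \<in> K" and t: "t \<in> {0<..<1}" and m: "mix t \<phi> \<psi> \<in> ?G" for \<phi> \<psi> t
  proof -
    have mem: "\<phi> \<in> F" "\<psi> \<in> F" using closed_faceD[OF assms(2) \<phi> \<psi> t] m by simp_all
    have eq: "t * (h x - h \<phi>) + (1 - t) * (h x - h \<psi>) = 0"
      using m affine[of t \<phi> \<psi>] by (simp add: algebra_simps)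
    have "t * (h x - h \<phi>) \<ge> 0" "(1 - t) * (h x - h \<psi>) \<ge> 0"
      using t x(2)[OF mem(1)] x(2)[OF mem(2)] by simp_all
    then have "t * (h x - h \<phi>) = 0" "(1 - t) * (h x - h \<psi>) = 0"
      using eq by linarith+
    then show ?thesis using t mem by simp
  qed
  ultimately have "closed_face K ?G"
    using x(1) by (intro closed_faceI) auto
  then show ?thesis using x(2) by blast
qed

lemma Re_Im_mix:
  "Re (mix t \<phi> \<psi> a) = t * Re (\<phi> a) + (1 - t) * Re (\<psi> a)"
  "Im (mix t \<phi> \<psi> a) = t * Im (\<phi> a) + (1 - t) * Im (\<psi> a)"
  by (simp_all add: mix_def)

lemma continuous_on_Re_Im_eval:
  fixes K :: "('a \<Rightarrow> complex) set"
  shows "continuous_on K (\<lambda>\<phi>. Re (\<phi> a))" "continuous_on K (\<lambda>\<phi>. Im (\<phi> a))"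
  by (intro continuous_intros continuous_on_subset[OF continuous_on_product_coordinates] subset_UNIV)+

text \<open>Nonemptiness is the finite intersection property in the compact \<open>K\<close>: a
  finite nonempty part of a chain has its smallest member as intersection. This supplies the bounds
  for Zorn's lemma.\<close>

lemma closed_face_Inter:
  assumes "compact K" and chain: "subset.chain {F. closed_face K F} \<F>" and "\<F> \<noteq> {}"
  shows "closed_face K (\<Inter>\<F>)"
proof -
  have F: "closed_face K F" if "F \<in> \<F>" for F
    using chain that by (auto simp: subset_chain_def)
  have "\<Inter>\<G> \<noteq> {}" if G: "finite \<G>" "\<G> \<subseteq> \<F>" for \<G>
  proof (cases "\<G> = {}")
    case False
    have "\<forall>X\<in>\<G>. \<forall>Y\<in>\<G>. X \<subseteq> Y \<or> Y \<subseteq> X"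
      using chain G(2) by (metis subset_chain_def subsetD)
    then have "subset.chain \<G> \<G>" by (simp add: subset_chain_def)
    then have "\<Inter>\<G> \<in> \<F>" using Inter_in_chain[OF G(1) False] G(2) by blast
    then show ?thesis using F[of "\<Inter>\<G>"] by (simp add: closed_face_def)
  qed simp
  moreover have "compact_space (top_of_set K)"
    using assms(1) by (simp add: compact_space_subtopology)
  moreover have "\<forall>F\<in>\<F>. closedin (top_of_set K) F" using F by (simp add: closed_face_def)
  ultimately have "\<Inter>\<F> \<noteq> {}" unfolding compact_space_fip by simp
  moreover have "closedin (top_of_set K) (\<Inter>\<F>)"
    using F assms(3) by (intro closedin_Inter) (simp_all add: closed_face_def)
  ultimately show ?thesis
  proof (rule closed_faceI)
    fix \<phi> \<psi> t assume *: "\<phi> \<in> K" "\<psi> \<in> K" "t \<in> {0<..<1}" "mix t \<phi> \<psi> \<in> \<Inter>\<F>"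
    show "\<phi> \<in> \<Inter>\<F> \<and> \<psi> \<in> \<Inter>\<F>"
    proof (intro conjI InterI)
      fix F' assume "F' \<in> \<F>"
      then show "\<phi> \<in> F'" "\<psi> \<in> F'"
        using closed_faceD[OF F *(1-3)] *(4) by simp_all
    qed
  qed
qed

text \<open>A minimal closed face is a point, because every evaluation is constant on it.\<close>

lemma compact_extremal_exists:
  fixes K :: "('a \<Rightarrow> complex) set"
  assumes "compact K" "K \<noteq> {}"
  shows "\<exists>\<rho>. extremal_in K \<rho> \<and> (\<forall>\<phi>\<in>K. Re (\<phi> c) \<le> Re (\<rho> c))"
proof -
  have "closed_face K K" using assms by (auto simp: closed_face_def)
  \<comment> \<open>Searching only inside the face where the evaluation at \<open>c\<close> is
    maximal gives the extra inequality of the conclusion.\<close>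
  then obtain m where F0: "closed_face K {\<phi>\<in>K. Re (\<phi> c) = m}" and m: "\<forall>\<phi>\<in>K. Re (\<phi> c) \<le> m"
    using closed_face_argmax[OF assms(1) _ continuous_on_Re_Im_eval(1) Re_Im_mix(1)] by blast
  define F\<^sub>0 where "F\<^sub>0 = {\<phi>\<in>K. Re (\<phi> c) = m}"
  define A where "A = {F. closed_face K F \<and> F \<subseteq> F\<^sub>0}"
  have "\<exists>F\<in>A. \<forall>X\<in>A. X \<subseteq> F \<longrightarrow> X = F"
  proof -
    \<comment> \<open>\<open>subset_Zorn\<close> produces maximal sets; a minimal face is obtained
      by passing to complements.\<close>
    have "\<exists>M\<in>uminus ` A. \<forall>X\<in>uminus ` A. M \<subseteq> X \<longrightarrow> X = M"
    proof (rule subset_Zorn)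
      fix \<C> assume C: "subset.chain (uminus ` A) \<C>"
      show "\<exists>U\<in>uminus ` A. \<forall>X\<in>\<C>. X \<subseteq> U"
      proof (cases "\<C> = {}")
        case True
        then show ?thesis using F0 by (auto simp: A_def F\<^sub>0_def)
      next
        case False
        have sub: "uminus ` \<C> \<subseteq> A" using C by (auto simp: subset_chain_def)
        have "subset.chain {F. closed_face K F} (uminus ` \<C>)"
          using C sub by (auto simp: subset_chain_def A_def)
        then have "closed_face K (\<Inter>(uminus ` \<C>))"
          using closed_face_Inter[OF assms(1)] False by blast
        moreover have "\<Inter>(uminus ` \<C>) \<subseteq> F\<^sub>0" using sub False unfolding A_def by blast
        ultimately have "\<Inter>(uminus ` \<C>) \<in> A" by (simp add: A_def)
        then have "- \<Inter>(uminus ` \<C>) \<in> uminus ` A" by (rule imageI)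
        then show ?thesis by (rule bexI[rotated]) auto
      qed
    qed
    then show ?thesis by simp
  qed
  then obtain F where FA: "F \<in> A" and minA: "\<forall>X\<in>A. X \<subseteq> F \<longrightarrow> X = F" ..
  then have F: "closed_face K F" "F \<subseteq> F\<^sub>0" by (simp_all add: A_def)
  have min: "X = F" if "closed_face K X" "X \<subseteq> F" for X
    using minA that F(2) by (simp add: A_def subset_trans[OF that(2)])
  \<comment> \<open>The part of \<open>F\<close> where \<open>h\<close> is maximal is again a closed
    face, hence all of \<open>F\<close> by minimality.\<close>
  have const: "\<exists>m. \<forall>\<phi>\<in>F. h \<phi> = m"
    if h: "continuous_on K h" "\<And>t \<phi> \<psi>. h (mix t \<phi> \<psi>) = t * h \<phi> + (1 - t) * h \<psi>"
    for h :: "('a \<Rightarrow> complex) \<Rightarrow> real"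
  proof -
    obtain m where "closed_face K {\<phi>\<in>F. h \<phi> = m}"
      using closed_face_argmax[OF assms(1) F(1) h] by blast
    then have "{\<phi>\<in>F. h \<phi> = m} = F" by (rule min) auto
    then show ?thesis by blast
  qed
  obtain \<rho> where \<rho>: "\<rho> \<in> F" using F(1) by (auto simp: closed_face_def)
  have "\<phi> = \<rho>" if "\<phi> \<in> F" for \<phi>
  proof
    fix a
    obtain m where m: "\<forall>\<phi>\<in>F. Re (\<phi> a) = m"
      using const[OF continuous_on_Re_Im_eval(1) Re_Im_mix(1)] ..
    obtain n where n: "\<forall>\<phi>\<in>F. Im (\<phi> a) = n"
      using const[OF continuous_on_Re_Im_eval(2) Re_Im_mix(2)] ..
    from m n show "\<phi> a = \<rho> a" using that \<rho> by (simp add: complex_eq_iff)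
  qed
  then have "F = {\<rho>}" using \<rho> by blast
  moreover have "\<rho> \<in> K" using F(2) \<rho> by (auto simp: F\<^sub>0_def)
  ultimately have "extremal_in K \<rho>"
    using closed_faceD[OF F(1)] by (auto simp: extremal_in_def)
  moreover have "Re (\<rho> c) = m" using F(2) \<rho> by (auto simp: F\<^sub>0_def)
  ultimately show ?thesis using m by auto
qed

section \<open>Elementary algebra of the involution and of C*-subalgebras\<close>

lemma scaleC_minus_one: "(-1) *\<^sub>C x = - x"
  using scaleC_of_real[of "-1" x] by simp

lemma scaleC_zero_left [simp]: "0 *\<^sub>C x = (0::'a::complex_normed_vector)"
  using scaleC_of_real[of 0 x] by simp

lemma scaleC_one [simp]: "1 *\<^sub>C x = (x::'a::complex_normed_vector)"
  using scaleC_of_real[of 1 x] by simp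

lemma star_diff: "star (a - b) = star a - star (b::'a::cstar_algebra_1)"
  using star_add[of a "(-1) *\<^sub>C b"] star_scaleC[of "-1" b] by (simp add: scaleC_minus_one)

text \<open>The C*-identity and submultiplicativity bound the square of \<open>norm b\<close> by
  \<open>norm (star b) * norm b\<close>; the reverse inequality is the same one for
  \<open>star a\<close>.\<close>

lemma norm_star [simp]: "norm (star a) = norm (a::'a::cstar_algebra_1)"
proof -
  have le: "norm b \<le> norm (star b)" for b :: 'a
  proof (cases "b = 0")
    case False
    have "norm b * norm b \<le> norm (star b) * norm b"
      using norm_mult_ineq[of "star b" b] by (simp add: cstar_identity power2_eq_square)
    then show ?thesis using False by simp
  qed simp
  show ?thesis using le[of a] le[of "star a"] by (simp add: star_star)
qed

lemma cstar_subalgebraD: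
  assumes "cstar_subalgebra L" "a \<in> L" "b \<in> L"
  shows "a + b \<in> L" "a - b \<in> L" "a * b \<in> L" "star a \<in> L" "c *\<^sub>C a \<in> L" "0 \<in> L"
proof -
  show *: "a + b \<in> L" "a * b \<in> L" "star a \<in> L" "c *\<^sub>C a \<in> L" "0 \<in> L"
    using assms by (simp_all add: cstar_subalgebra_def complex_subspace_def)
  have "(-1) *\<^sub>C b \<in> L"
    using assms unfolding cstar_subalgebra_def complex_subspace_def by blast
  then have "a + (-1) *\<^sub>C b \<in> L"
    using assms unfolding cstar_subalgebra_def complex_subspace_def by blast
  then show "a - b \<in> L" by (simp add: scaleC_minus_one)
qed

lemma cstar_subalgebra_zero: "cstar_subalgebra L \<Longrightarrow> 0 \<in> L"
  by (simp add: cstar_subalgebra_def complex_subspace_def)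

lemma cstar_subalgebra_UNIV: "cstar_subalgebra UNIV"
  by (simp add: cstar_subalgebra_def complex_subspace_def)

section \<open>Positive functionals\<close>

text \<open>States of a non-unital algebra need not form a compact set. Replacing norm one by a
  contraction bound leaves only conditions that are closed under pointwise convergence.\<close>

definition quasi_states :: "'a::cstar_algebra_1 set \<Rightarrow> ('a \<Rightarrow> complex) set" where
  "quasi_states A = {\<phi> \<in> extensional A.
     (\<forall>a\<in>A. \<forall>b\<in>A. \<phi> (a + b) = \<phi> a + \<phi> b) \<and>
     (\<forall>c. \<forall>a\<in>A. \<phi> (c *\<^sub>C a) = c * \<phi> a) \<and>
     (\<forall>a\<in>A. \<phi> (star a * a) \<in> \<real>\<^sub>\<ge>\<^sub>0) \<and>
     (\<forall>a\<in>A. cmod (\<phi> a) \<le> norm a)}"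

lemma quasi_statesD:
  assumes "\<phi> \<in> quasi_states L"
  shows "a \<in> L \<Longrightarrow> b \<in> L \<Longrightarrow> \<phi> (a + b) = \<phi> a + \<phi> b"
    and "a \<in> L \<Longrightarrow> \<phi> (c *\<^sub>C a) = c * \<phi> a"
    and "a \<in> L \<Longrightarrow> Re (\<phi> (star a * a)) \<ge> 0"
    and "a \<in> L \<Longrightarrow> Im (\<phi> (star a * a)) = 0"
    and "a \<in> L \<Longrightarrow> cmod (\<phi> a) \<le> norm a"
    and "a \<notin> L \<Longrightarrow> \<phi> a = undefined"
  using assms by (auto simp: quasi_states_def complex_nonneg_Reals_iff extensional_def)

lemma quasi_statesI:
  assumes "\<And>a b. a \<in> L \<Longrightarrow> b \<in> L \<Longrightarrow> \<phi> (a + b) = \<phi> a + \<phi> b"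
    and "\<And>c a. a \<in> L \<Longrightarrow> \<phi> (c *\<^sub>C a) = c * \<phi> a"
    and "\<And>a. a \<in> L \<Longrightarrow> Re (\<phi> (star a * a)) \<ge> 0"
    and "\<And>a. a \<in> L \<Longrightarrow> Im (\<phi> (star a * a)) = 0"
    and "\<And>a. a \<in> L \<Longrightarrow> cmod (\<phi> a) \<le> norm a"
    and "\<And>a. a \<notin> L \<Longrightarrow> \<phi> a = undefined"
  shows "\<phi> \<in> quasi_states L"
  using assms by (simp add: quasi_states_def complex_nonneg_Reals_iff extensional_def)

lemma quasi_states_diff:
  assumes "cstar_subalgebra L" "\<phi> \<in> quasi_states L" "a \<in> L" "b \<in> L"
  shows "\<phi> (a - b) = \<phi> a - \<phi> b"
proof -
  have "\<phi> (a + (-1) *\<^sub>C b) = \<phi> a + \<phi> ((-1) *\<^sub>C b)"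
    using quasi_statesD(1)[OF assms(2,3)] cstar_subalgebraD(5)[OF assms(1,4,4)] by blast
  then show ?thesis using quasi_statesD(2)[OF assms(2,4), of "-1"] by (simp add: scaleC_minus_one)
qed

lemma functional_norm_upper:
  assumes "\<phi> \<in> dual_space L" "a \<in> L" "norm a \<le> 1"
  shows "cmod (\<phi> a) \<le> functional_norm L \<phi>"
proof -
  obtain K where K: "\<forall>a\<in>L. cmod (\<phi> a) \<le> K * norm a"
    using assms(1) by (auto simp: dual_space_def)
  have "cmod (\<phi> b) \<le> \<bar>K\<bar>" if "b \<in> L" "norm b \<le> 1" for b
  proof -
    have "cmod (\<phi> b) \<le> K * norm b" using K that by blast
    also have "\<dots> \<le> \<bar>K\<bar> * 1" using that by (intro mult_mono) auto
    finally show ?thesis by simp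
  qed
  then have "bdd_above ((\<lambda>a. cmod (\<phi> a)) ` {a \<in> L. norm a \<le> 1})"
    by (auto intro!: bdd_aboveI[of _ "\<bar>K\<bar>"])
  then show ?thesis unfolding functional_norm_def using assms(2,3) by (intro cSUP_upper) auto
qed

lemma functional_norm_least:
  assumes "0 \<in> L" "\<And>a. a \<in> L \<Longrightarrow> norm a \<le> 1 \<Longrightarrow> cmod (\<phi> a) \<le> K"
  shows "functional_norm L \<phi> \<le> K"
  unfolding functional_norm_def using assms by (intro cSUP_least) (auto intro!: exI[of _ 0])

lemma functional_norm_bound:
  assumes "cstar_subalgebra L" "\<phi> \<in> dual_space L" "a \<in> L"
  shows "cmod (\<phi> a) \<le> functional_norm L \<phi> * norm a"
proof (cases "a = 0")
  case True
  have "\<phi> (0 *\<^sub>C a) = 0 * \<phi> a" using assms(2,3) unfolding dual_space_def by blast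
  then show ?thesis using True by simp
next
  case False
  define c where "c = complex_of_real (1 / norm a)"
  have "cmod (\<phi> (c *\<^sub>C a)) \<le> functional_norm L \<phi>"
    using False cstar_subalgebraD(5)[OF assms(1,3,3)]
    by (intro functional_norm_upper[OF assms(2)]) (auto simp: c_def norm_scaleC norm_divide)
  moreover have "\<phi> (c *\<^sub>C a) = c * \<phi> a" using assms(2,3) unfolding dual_space_def by blast
  ultimately have "cmod c * cmod (\<phi> a) \<le> functional_norm L \<phi>" by (simp only: norm_mult)
  then show ?thesis using False by (simp add: c_def norm_divide field_simps)
qed

lemma quasi_states_subset_dual: "quasi_states L \<subseteq> dual_space L"
  by (auto simp: quasi_states_def dual_space_def intro!: exI[of _ 1])

lemma state_space_quasi:
  assumes "cstar_subalgebra L"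
  shows "\<phi> \<in> state_space L \<longleftrightarrow> \<phi> \<in> quasi_states L \<and> functional_norm L \<phi> = 1"
proof
  assume \<phi>: "\<phi> \<in> state_space L"
  then have "cmod (\<phi> a) \<le> norm a" if "a \<in> L" for a
    using functional_norm_bound[OF assms _ that, of \<phi>] by (simp add: state_space_def)
  then show "\<phi> \<in> quasi_states L \<and> functional_norm L \<phi> = 1"
    using \<phi> by (simp add: state_space_def dual_space_def quasi_states_def)
next
  assume "\<phi> \<in> quasi_states L \<and> functional_norm L \<phi> = 1"
  then show "\<phi> \<in> state_space L"
    using quasi_states_subset_dual[of L] by (auto simp: state_space_def quasi_states_def)
qed

text \<open>Substitute for the value at a unit: the supremum defining the norm is nearly attained,
  and a phase factor turns the modulus into a real part.\<close>

lemma state_near_one: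
  assumes L: "cstar_subalgebra L" and \<phi>: "\<phi> \<in> state_space L" and "\<epsilon> > 0"
  shows "\<exists>a\<in>L. norm a \<le> 1 \<and> Re (\<phi> a) > 1 - \<epsilon>"
proof -
  have \<phi>': "\<phi> \<in> quasi_states L" "functional_norm L \<phi> = 1"
    using \<phi> state_space_quasi[OF L] by auto
  \<comment> \<open>The cap at 1 keeps \<open>1 - \<delta>\<close> nonnegative, so that
    \<open>\<phi> a\<close> is nonzero and has a phase.\<close>
  define \<delta> where "\<delta> = min \<epsilon> 1"
  have \<delta>: "0 < \<delta>" "\<delta> \<le> 1" "\<delta> \<le> \<epsilon>" using assms(3) by (auto simp: \<delta>_def)
  have "\<exists>a\<in>L. norm a \<le> 1 \<and> cmod (\<phi> a) > 1 - \<delta>"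
  proof (rule ccontr)
    assume "\<not> ?thesis"
    then have "cmod (\<phi> a) \<le> 1 - \<delta>" if "a \<in> L" "norm a \<le> 1" for a
      using that by force
    then have "functional_norm L \<phi> \<le> 1 - \<delta>"
      using cstar_subalgebra_zero[OF L] by (intro functional_norm_least)
    then show False using \<phi>'(2) \<delta> by simp
  qed
  then obtain a where a: "a \<in> L" "norm a \<le> 1" "cmod (\<phi> a) > 1 - \<delta>" by blast
  define c where "c = cnj (sgn (\<phi> a))"
  have nz: "\<phi> a \<noteq> 0" using a(3) \<delta> by auto
  have "\<phi> (c *\<^sub>C a) = c * \<phi> a" using quasi_statesD(2)[OF \<phi>'(1) a(1)] .
  also have "\<dots> = of_real (cmod (\<phi> a))"
    using nz complex_norm_square[of "\<phi> a"]
    by (simp add: c_def sgn_eq power2_eq_square field_simps)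
  finally have "Re (\<phi> (c *\<^sub>C a)) > 1 - \<epsilon>" using a(3) \<delta>(3) by simp
  moreover have "norm (c *\<^sub>C a) \<le> 1" using a(2) nz by (simp add: norm_scaleC c_def norm_sgn)
  ultimately show ?thesis using cstar_subalgebraD(5)[OF L a(1,1)] by blast
qed

text \<open>Both parts come from positivity at \<open>a + c *\<^sub>C b\<close>. The values 1 and
  \<i> of \<open>c\<close> give the hermitian symmetry; multiples of \<open>t\<close> give a real
  quadratic whose positivity is the inequality.\<close>

lemma
  assumes L: "cstar_subalgebra L" and \<phi>: "\<phi> \<in> quasi_states L" and a: "a \<in> L" and b: "b \<in> L"
  shows quasi_state_hermitian: "\<phi> (star b * a) = cnj (\<phi> (star a * b))"
    and quasi_state_Cauchy_Schwarz:
      "(cmod (\<phi> (star b * a)))\<^sup>2 \<le> Re (\<phi> (star a * a)) * Re (\<phi> (star b * b))"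
proof -
  define s t A B where "s = \<phi> (star a * b)" and "t = \<phi> (star b * a)"
    and "A = \<phi> (star a * a)" and "B = \<phi> (star b * b)"
  note sub = cstar_subalgebraD[OF L]
  note lin = quasi_statesD[OF \<phi>]
  have expand: "\<phi> (star (a + c *\<^sub>C b) * (a + c *\<^sub>C b)) = A + c * s + cnj c * t + c * cnj c * B" for c
  proof -
    have "star (a + c *\<^sub>C b) * (a + c *\<^sub>C b) =
        (star a * a + c *\<^sub>C (star a * b)) + (cnj c *\<^sub>C (star b * a) + (c * cnj c) *\<^sub>C (star b * b))"
      by (simp add: star_add star_scaleC distrib_left distrib_right mult_scaleC_left
          mult_scaleC_right scaleC_scaleC scaleC_add_right mult.commute)
    then show ?thesis
      using a b by (simp add: lin(1,2) sub s_def t_def A_def B_def)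
  qed
  have mem: "a + c *\<^sub>C b \<in> L" for c using a b sub(1,5) by blast
  have AB: "Im A = 0" "Im B = 0" "Re A \<ge> 0" "Re B \<ge> 0"
    using lin(3,4) a b by (auto simp: A_def B_def)
  have "Im s + Im t = 0" using lin(4)[OF mem[of 1]] expand[of 1] AB by simp
  moreover have "Re s - Re t = 0" using lin(4)[OF mem[of \<i>]] expand[of \<i>] AB by simp
  ultimately have ts: "t = cnj s" by (simp add: complex_eq_iff)
  then show "\<phi> (star b * a) = cnj (\<phi> (star a * b))" by (simp add: s_def t_def)
  define n where "n = (cmod t)\<^sup>2"
  have "s * cnj s = of_real n" by (simp only: n_def ts complex_mod_cnj complex_norm_square)
  then have st: "t * s = of_real n" "t * cnj t = of_real n"
    by (simp_all add: ts mult.commute)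
  have quad: "0 \<le> Re A - 2 * r * n + r\<^sup>2 * n * Re B" for r
  proof -
    \<comment> \<open>The factor \<open>t\<close> cancels the phase, so both cross terms become the
      real number \<open>- r * n\<close>.\<close>
    define c where "c = - of_real r * t"
    have "0 \<le> Re (A + c * s + cnj c * t + c * cnj c * B)"
      using lin(3)[OF mem[of c]] expand[of c] by simp
    also have "A + c * s + cnj c * t + c * cnj c * B = A - of_real (2 * r * n) + of_real (r\<^sup>2 * n) * B"
    proof -
      have "c * s = - of_real r * (t * s)" "cnj c * t = - of_real r * (t * cnj t)"
        "c * cnj c = of_real r * of_real r * (t * cnj t)"
        by (simp_all add: c_def)
      then show ?thesis unfolding st by (simp add: algebra_simps power2_eq_square)
    qed
    also have "Re \<dots> = Re A - 2 * r * n + r\<^sup>2 * n * Re B" by simp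
    finally show ?thesis .
  qed
  have "n \<le> Re A * Re B"
  proof (cases "Re B = 0")
    case True
    have "n = 0"
    proof (rule ccontr)
      assume "n \<noteq> 0"
      \<comment> \<open>With \<open>Re B = 0\<close> the quadratic is affine in \<open>r\<close>;
        this \<open>r\<close> gives it the value -1.\<close>
      then show False using quad[of "(Re A + 1) / (2 * n)"] True AB by (simp add: field_simps)
    qed
    then show ?thesis using AB by simp
  next
    case False
    then have "Re B > 0" using AB by simp
    then show ?thesis using quad[of "1 / Re B"] by (simp add: field_simps power2_eq_square)
  qed
  then show "(cmod (\<phi> (star b * a)))\<^sup>2 \<le> Re (\<phi> (star a * a)) * Re (\<phi> (star b * b))"
    by (simp add: n_def t_def A_def B_def)
qed

lemma mix_quasi_states:
  assumes "\<phi> \<in> quasi_states L" "\<psi> \<in> quasi_states L" "0 \<le> t" "t \<le> 1"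
  shows "mix t \<phi> \<psi> \<in> quasi_states L"
proof -
  have "cmod (mix t \<phi> \<psi> a) \<le> norm a" if "a \<in> L" for a
  proof -
    have "cmod (mix t \<phi> \<psi> a) \<le> t * cmod (\<phi> a) + (1 - t) * cmod (\<psi> a)"
      unfolding mix_def using assms(3,4)
      by (intro order_trans[OF norm_triangle_ineq]) (simp add: norm_mult del: of_real_diff)
    also have "\<dots> \<le> t * norm a + (1 - t) * norm a"
      using assms that by (intro add_mono mult_left_mono) (auto simp: quasi_states_def)
    finally show ?thesis by (simp add: algebra_simps)
  qed
  moreover have "Re (mix t \<phi> \<psi> (star a * a)) \<ge> 0" if "a \<in> L" for a
    unfolding Re_Im_mix using quasi_statesD(3)[OF assms(1) that] quasi_statesD(3)[OF assms(2) that]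
      assms(3,4) by simp
  ultimately show ?thesis
    using quasi_statesD[OF assms(1)] quasi_statesD[OF assms(2)]
    by (intro quasi_statesI) (simp_all add: mix_def algebra_simps)
qed

text \<open>The Banach-Alaoglu argument: a product of discs of radius \<open>norm a\<close>, and of
  singletons outside \<open>L\<close>, is compact by Tychonoff, and the remaining conditions are
  closed.\<close>

lemma compact_quasi_states: "compact (quasi_states L)"
proof -
  define S where "S a = (if a \<in> L then cball (0::complex) (norm a) else {undefined})" for a
  have "compact (PiE UNIV S)"
    using compactin_PiE[of "\<lambda>_. euclidean" UNIV S]
    by (auto simp: euclidean_product_topology S_def)
  moreover have "closed {\<phi>::'a \<Rightarrow> complex. (\<forall>a. a \<in> L \<longrightarrow> (\<forall>b. b \<in> L \<longrightarrow> \<phi> (a + b) = \<phi> a + \<phi> b)) \<and>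
     (\<forall>c a. a \<in> L \<longrightarrow> \<phi> (c *\<^sub>C a) = c * \<phi> a) \<and>
     (\<forall>a. a \<in> L \<longrightarrow> 0 \<le> Re (\<phi> (star a * a)) \<and> Im (\<phi> (star a * a)) = 0)}" (is "closed ?C")
    by (intro closed_Collect_conj closed_Collect_all closed_Collect_imp closed_Collect_eq
        closed_Collect_le continuous_intros continuous_on_product_coordinates open_Collect_const)
  moreover have "quasi_states L = PiE UNIV S \<inter> ?C"
    by (auto simp: quasi_states_def S_def extensional_def PiE_def Pi_def complex_nonneg_Reals_iff
        split: if_splits)
  ultimately show ?thesis by (simp add: compact_Int_closed)
qed

text \<open>The zero functional is an extremal quasi-state and must be excluded. Some state has
  positive real part at \<open>c\<close>, so an extremal point maximising this real part is nonzero,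
  and extremality then forces its norm up to 1.\<close>

lemma pure_state_exists:
  assumes L: "cstar_subalgebra L" and "state_space L \<noteq> {}"
  shows "\<exists>\<rho>. extremal_in (state_space L) \<rho>"
proof -
  obtain \<sigma> where \<sigma>: "\<sigma> \<in> state_space L" using assms(2) by blast
  obtain c where c: "c \<in> L" "Re (\<sigma> c) > 0"
    using state_near_one[OF L \<sigma>, of 1] by auto
  have "\<sigma> \<in> quasi_states L" using \<sigma> state_space_quasi[OF L] by blast
  then obtain \<rho> where \<rho>: "extremal_in (quasi_states L) \<rho>" "Re (\<rho> c) > 0"
    using compact_extremal_exists[OF compact_quasi_states, of L c] c
    by (metis empty_iff order_less_le_trans)
  have q: "\<rho> \<in> quasi_states L" using \<rho>(1) by (simp add: extremal_in_def)
  then have d: "\<rho> \<in> dual_space L" using quasi_states_subset_dual by blast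
  define r where "r = functional_norm L \<rho>"
  have bound: "cmod (\<rho> a) \<le> r * norm a" if "a \<in> L" for a
    using functional_norm_bound[OF L d that] by (simp add: r_def)
  have "r \<le> 1"
    unfolding r_def using quasi_statesD(5)[OF q] cstar_subalgebra_zero[OF L]
    by (intro functional_norm_least) force+
  have "r > 0"
  proof (rule ccontr)
    assume "\<not> r > 0"
    then have "r * norm c \<le> 0" by (simp add: mult_nonpos_nonneg)
    then have "cmod (\<rho> c) \<le> 0" using bound[OF c(1)] by linarith
    then show False using \<rho>(2) by simp
  qed
  have "r = 1"
  proof (rule ccontr)
    assume "r \<noteq> 1"
    then have r: "r \<in> {0<..<1}" using \<open>r > 0\<close> \<open>r \<le> 1\<close> by simp
    \<comment> \<open>A norm \<open>r\<close> strictly between 0 and 1 would exhibit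
      \<open>\<rho>\<close> as a mixture of its normalisation and of 0.\<close>
    define \<phi> where "\<phi> = restrict (\<lambda>a. \<rho> a / of_real r) L"
    define \<psi> where "\<psi> = restrict (\<lambda>a::'a. 0::complex) L"
    note sub = cstar_subalgebraD[OF L]
    have "\<phi> \<in> quasi_states L"
      using quasi_statesD[OF q] bound \<open>r > 0\<close> unfolding \<phi>_def
      by (intro quasi_statesI)
        (simp_all add: sub add_divide_distrib norm_divide pos_divide_le_eq mult.commute)
    moreover have "\<psi> \<in> quasi_states L"
      unfolding \<psi>_def by (intro quasi_statesI) (simp_all add: sub)
    moreover have "\<rho> = mix r \<phi> \<psi>"
      using \<open>r > 0\<close> quasi_statesD(6)[OF q]
      by (auto simp: fun_eq_iff mix_def \<phi>_def \<psi>_def algebra_simps)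
    ultimately have "\<psi> = \<rho>" using \<rho>(1) r by (auto simp: extremal_in_def)
    then show False using \<rho>(2) c(1) by (auto simp: \<psi>_def)
  qed
  then have "\<rho> \<in> state_space L" using q state_space_quasi[OF L] by (simp add: r_def)
  moreover have "state_space L \<subseteq> quasi_states L" using state_space_quasi[OF L] by blast
  ultimately have "extremal_in (state_space L) \<rho>"
    using \<rho>(1) by (auto simp: extremal_in_def)
  then show ?thesis by blast
qed

section \<open>Approximate identities\<close>

lemma approximate_identityD:
  fixes L :: "'a::cstar_algebra_1 set"
  assumes "approximate_identity L G"
  shows "G \<noteq> bot" "\<forall>\<^sub>F e in G. e \<in> L \<and> star e = e \<and> norm e \<le> 1"
    and "a \<in> L \<Longrightarrow> ((\<lambda>e. e * a) \<longlongrightarrow> a) G" "a \<in> L \<Longrightarrow> ((\<lambda>e. a * e) \<longlongrightarrow> a) G"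
proof -
  show "G \<noteq> bot" "a \<in> L \<Longrightarrow> ((\<lambda>e. e * a) \<longlongrightarrow> a) G" "a \<in> L \<Longrightarrow> ((\<lambda>e. a * e) \<longlongrightarrow> a) G"
    using assms by (simp_all add: approximate_identity_def)
  have "\<forall>\<^sub>F e in G. e \<in> L \<and> (\<exists>a\<in>L. e = star a * a) \<and> norm e \<le> 1"
    using assms by (simp add: approximate_identity_def)
  then show "\<forall>\<^sub>F e in G. e \<in> L \<and> star e = e \<and> norm e \<le> 1"
    by eventually_elim (auto simp: star_mult star_star)
qed

lemma quasi_state_tendsto:
  assumes L: "cstar_subalgebra L" and \<phi>: "\<phi> \<in> quasi_states L" and a: "a \<in> L"
    and f: "(f \<longlongrightarrow> a) G" and mem: "\<forall>\<^sub>F e in G. f e \<in> L"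
  shows "((\<lambda>e. \<phi> (f e)) \<longlongrightarrow> \<phi> a) G"
proof (rule LIM_zero_cancel, rule Lim_null_comparison)
  show "\<forall>\<^sub>F e in G. cmod (\<phi> (f e) - \<phi> a) \<le> norm (f e - a)"
    using mem
  proof eventually_elim
    case (elim e)
    have "cmod (\<phi> (f e - a)) \<le> norm (f e - a)"
      using quasi_statesD(5)[OF \<phi> cstar_subalgebraD(2)[OF L elim a]] .
    then show ?case by (simp add: quasi_states_diff[OF L \<phi> elim a])
  qed
  show "((\<lambda>e. norm (f e - a)) \<longlongrightarrow> 0) G"
    using tendsto_norm_zero[OF LIM_zero[OF f]] .
qed

text \<open>\<open>\<phi> (e * a)\<close> tends to \<open>\<phi> a\<close>, which is nearly 1 for a
  suitable \<open>a\<close>. By Cauchy-Schwarz its squared modulus is at most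
  \<open>\<phi> (e * e)\<close>, because \<open>\<phi> (star a * a)\<close> is at most 1.\<close>

lemma state_approximate_identity:
  assumes L: "cstar_subalgebra L" and \<phi>: "\<phi> \<in> state_space L"
    and G: "approximate_identity L G" and "\<epsilon> > 0"
  shows "\<forall>\<^sub>F e in G. Re (\<phi> (e * e)) > 1 - \<epsilon>"
proof -
  have q: "\<phi> \<in> quasi_states L" using \<phi> state_space_quasi[OF L] by blast
  note D = approximate_identityD[OF G]
  define \<delta> where "\<delta> = min \<epsilon> 1"
  have \<delta>: "0 < \<delta>" "\<delta> \<le> 1" "\<delta> \<le> \<epsilon>" using assms(4) by (auto simp: \<delta>_def)
  obtain a where a: "a \<in> L" "norm a \<le> 1" "Re (\<phi> a) > 1 - \<delta> / 2"
    using state_near_one[OF L \<phi>, of "\<delta> / 2"] \<delta> by auto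
  have mem: "\<forall>\<^sub>F e in G. e * a \<in> L"
    using D(2) by eventually_elim (simp add: cstar_subalgebraD(3)[OF L _ a(1)])
  have "((\<lambda>e. cmod (\<phi> (e * a))) \<longlongrightarrow> cmod (\<phi> a)) G"
    by (intro tendsto_norm quasi_state_tendsto[OF L q a(1) D(3)[OF a(1)] mem])
  moreover have "1 - \<delta> / 2 < cmod (\<phi> a)" using a(3) complex_Re_le_cmod[of "\<phi> a"] by linarith
  ultimately have "\<forall>\<^sub>F e in G. cmod (\<phi> (e * a)) > 1 - \<delta> / 2"
    by (rule order_tendstoD)
  then show ?thesis using D(2)
  proof eventually_elim
    case (elim e)
    have e: "e \<in> L" "star e = e" using elim by auto
    have aa: "Re (\<phi> (star a * a)) \<le> 1"
    proof -
      have "Re (\<phi> (star a * a)) \<le> norm (star a * a)"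
        using quasi_statesD(5)[OF q, of "star a * a"] complex_Re_le_cmod[of "\<phi> (star a * a)"]
          cstar_subalgebraD(3)[OF L cstar_subalgebraD(4)[OF L a(1,1)] a(1)] by linarith
      also have "\<dots> \<le> 1" using a(2) by (simp add: cstar_identity power_le_one)
      finally show ?thesis .
    qed
    have "1 - \<delta> \<le> (1 - \<delta> / 2)\<^sup>2" by (simp add: power2_eq_square algebra_simps)
    also have "\<dots> < (cmod (\<phi> (e * a)))\<^sup>2"
      using elim(1) \<delta> by (intro power_strict_mono) auto
    also have "\<dots> \<le> Re (\<phi> (star a * a)) * Re (\<phi> (e * e))"
      using quasi_state_Cauchy_Schwarz[OF L q a(1) e(1)] e(2) by simp
    also have "\<dots> \<le> 1 * Re (\<phi> (e * e))"
      using aa quasi_statesD(3)[OF q e(1)] e(2) by (intro mult_right_mono) auto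
    finally show ?case using \<delta>(3) by simp
  qed
qed

text \<open>The point is that the norm does not drop. Two states could be nearly 1 on different
  elements, but far along an approximate identity the same \<open>e * e\<close> serves both.\<close>

lemma mix_state_space:
  assumes L: "cstar_subalgebra L" and G: "approximate_identity L G"
    and \<phi>: "\<phi> \<in> state_space L" and \<psi>: "\<psi> \<in> state_space L" and t: "0 \<le> t" "t \<le> 1"
  shows "mix t \<phi> \<psi> \<in> state_space L"
proof -
  let ?m = "mix t \<phi> \<psi>"
  have q: "\<phi> \<in> quasi_states L" "\<psi> \<in> quasi_states L" using \<phi> \<psi> state_space_quasi[OF L] by auto
  have m: "?m \<in> quasi_states L" using mix_quasi_states[OF q t] .
  have "functional_norm L ?m \<le> 1"
    using quasi_statesD(5)[OF m] cstar_subalgebra_zero[OF L]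
    by (intro functional_norm_least) force+
  moreover have "1 \<le> functional_norm L ?m + \<epsilon>" if "\<epsilon> > 0" for \<epsilon>
  proof -
    have "\<forall>\<^sub>F e in G. (e \<in> L \<and> star e = e \<and> norm e \<le> 1) \<and>
        Re (\<phi> (e * e)) > 1 - \<epsilon> \<and> Re (\<psi> (e * e)) > 1 - \<epsilon>"
      using approximate_identityD(2)[OF G] state_approximate_identity[OF L \<phi> G that]
        state_approximate_identity[OF L \<psi> G that] by eventually_elim simp
    then obtain e where e: "e \<in> L" "norm e \<le> 1"
      "Re (\<phi> (e * e)) > 1 - \<epsilon>" "Re (\<psi> (e * e)) > 1 - \<epsilon>"
      using eventually_happens'[OF approximate_identityD(1)[OF G]] by blast
    have "1 - \<epsilon> = t * (1 - \<epsilon>) + (1 - t) * (1 - \<epsilon>)" by (simp add: algebra_simps)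
    also have "\<dots> \<le> Re (?m (e * e))"
      unfolding Re_Im_mix using e t by (intro add_mono mult_left_mono) auto
    also have "\<dots> \<le> cmod (?m (e * e))" by (rule complex_Re_le_cmod)
    also have "\<dots> \<le> functional_norm L ?m"
    proof (rule functional_norm_upper)
      show "?m \<in> dual_space L" using m quasi_states_subset_dual by blast
      show "e * e \<in> L" using cstar_subalgebraD(3)[OF L e(1) e(1)] .
      show "norm (e * e) \<le> 1"
        using norm_mult_ineq[of e e] e(2) mult_le_one[OF e(2) norm_ge_zero e(2)] by linarith
    qed
    finally show ?thesis by simp
  qed
  then have "1 \<le> functional_norm L ?m" by (rule field_le_epsilon)
  ultimately show ?thesis using m state_space_quasi[OF L] by simp
qed

section \<open>The limit defining the host map\<close>

text \<open>An \<open>a\<close> with \<open>\<phi> a\<close> nearly 1 behaves under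
  \<open>\<phi>\<close> like \<open>e\<close>: the seminorm of \<open>e - a\<close> is small, so
  Cauchy-Schwarz permits replacing the right factor \<open>e\<close> by \<open>a\<close>. The left
  factor then disappears because \<open>x * a\<close> lies in \<open>L\<close>. The comparison value
  does not involve \<open>G\<close>.\<close>

lemma state_host_estimate:
  assumes L: "cstar_subalgebra L" "closed_two_sided_ideal L" and \<phi>: "\<phi> \<in> state_space L"
    and G: "approximate_identity L G" and "\<epsilon> > 0"
    and a: "a \<in> L" "norm a \<le> 1" "Re (\<phi> a) > 1 - \<epsilon>"
  shows "\<forall>\<^sub>F e in G. cmod (\<phi> (e * x * e) - \<phi> (x * a)) \<le> norm x * sqrt (4 * \<epsilon>) + \<epsilon>"
proof -
  have q: "\<phi> \<in> quasi_states L" using \<phi> state_space_quasi[OF L(1)] by blast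
  note D = approximate_identityD[OF G]
  note sub = cstar_subalgebraD[OF L(1)]
  have ideal: "x * b \<in> L" "b * x \<in> L" if "b \<in> L" for b x
    using L(2) that by (auto simp: closed_two_sided_ideal_def)
  have mem: "\<forall>\<^sub>F e in G. e * b \<in> L" for b
    using D(2) by eventually_elim (simp add: ideal)
  have "((\<lambda>e. Re (\<phi> (e * a))) \<longlongrightarrow> Re (\<phi> a)) G"
    by (intro tendsto_Re quasi_state_tendsto[OF L(1) q a(1) D(3)[OF a(1)] mem])
  then have "\<forall>\<^sub>F e in G. Re (\<phi> (e * a)) > 1 - 2 * \<epsilon>"
    by (rule order_tendstoD) (use a(3) assms(5) in linarith)
  moreover have "\<forall>\<^sub>F e in G. dist (\<phi> (e * (x * a))) (\<phi> (x * a)) < \<epsilon>"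
    using ideal(1)[OF a(1)] assms(5)
    by (intro tendstoD quasi_state_tendsto[OF L(1) q _ D(3) mem]) auto
  ultimately show ?thesis using D(2)
  proof eventually_elim
    case (elim e)
    have e: "e \<in> L" "star e = e" "norm e \<le> 1" using elim by auto
    have bound: "Re (\<phi> (star b * b)) \<le> (norm b)\<^sup>2" if "b \<in> L" for b
      using quasi_statesD(5)[OF q ideal(1)[OF that, of "star b"]]
        complex_Re_le_cmod[of "\<phi> (star b * b)"] by (simp add: cstar_identity)
    define b where "b = star x * e"
    have b: "b \<in> L" "star b = e * x" using e by (auto simp: b_def ideal star_mult star_star)
    have ea: "e - a \<in> L" using sub(2)[OF e(1) a(1)] .
    have "\<phi> (star (e - a) * (e - a)) = \<phi> ((e * e - e * a) - (star a * e - star a * a))"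
      by (simp add: star_diff e algebra_simps)
    also have "\<dots> = (\<phi> (e * e) - \<phi> (e * a)) - (\<phi> (star a * e) - \<phi> (star a * a))"
      using a(1) e(1) by (simp add: quasi_states_diff[OF L(1) q] ideal sub(2))
    also have "\<phi> (star a * e) = cnj (\<phi> (e * a))"
      using quasi_state_hermitian[OF L(1) q e(1) a(1)] e(2) by simp
    finally have "Re (\<phi> (star (e - a) * (e - a))) =
        Re (\<phi> (star e * e)) - 2 * Re (\<phi> (e * a)) + Re (\<phi> (star a * a))"
      using e(2) by simp
    \<comment> \<open>Since \<open>Re (\<phi> (e * a))\<close> exceeds
      \<open>1 - 2 * \<epsilon>\<close>, this bound is at most
      \<open>4 * \<epsilon>\<close>.\<close>
    also have "\<dots> \<le> 1 - 2 * Re (\<phi> (e * a)) + 1"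
      using bound[OF e(1)] bound[OF a(1)] power_le_one[OF norm_ge_zero e(3), of 2]
        power_le_one[OF norm_ge_zero a(2), of 2] by linarith
    also have "\<dots> \<le> 4 * \<epsilon>" using elim(1) by simp
    finally have small: "Re (\<phi> (star (e - a) * (e - a))) \<le> 4 * \<epsilon>" .
    have "norm b \<le> norm x * 1"
      unfolding b_def using norm_mult_ineq[of "star x" e] e(3)
      by (metis mult_left_mono norm_ge_zero norm_star order_trans)
    then have "Re (\<phi> (star b * b)) \<le> (norm x)\<^sup>2"
      using bound[OF b(1)] power_mono[of "norm b" "norm x" 2] norm_ge_zero[of b] by linarith
    then have "Re (\<phi> (star (e - a) * (e - a))) * Re (\<phi> (star b * b)) \<le> (4 * \<epsilon>) * (norm x)\<^sup>2"
      using small quasi_statesD(3)[OF q b(1)] assms(5) by (intro mult_mono) auto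
    moreover have "(4 * \<epsilon>) * (norm x)\<^sup>2 = (norm x * sqrt (4 * \<epsilon>))\<^sup>2"
      using assms(5) by (simp add: power_mult_distrib)
    ultimately have "(cmod (\<phi> (star b * (e - a))))\<^sup>2 \<le> (norm x * sqrt (4 * \<epsilon>))\<^sup>2"
      using quasi_state_Cauchy_Schwarz[OF L(1) q ea b(1)] by linarith
    then have "cmod (\<phi> (star b * (e - a))) \<le> norm x * sqrt (4 * \<epsilon>)"
      by (rule power2_le_imp_le) (use assms(5) in simp)
    moreover have "\<phi> (star b * (e - a)) = \<phi> (e * x * e) - \<phi> (e * (x * a))"
    proof -
      have "star b * (e - a) = e * x * e - e * (x * a)"
        unfolding b(2) by (simp only: right_diff_distrib mult.assoc)
      moreover have "e * x * e \<in> L" "e * (x * a) \<in> L" using a(1) e(1) ideal by blast+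
      ultimately show ?thesis using quasi_states_diff[OF L(1) q] by simp
    qed
    ultimately have "cmod (\<phi> (e * x * e) - \<phi> (e * (x * a))) \<le> norm x * sqrt (4 * \<epsilon>)" by simp
    moreover have "cmod (\<phi> (e * (x * a)) - \<phi> (x * a)) \<le> \<epsilon>" using elim(2) by (simp add: dist_norm)
    ultimately show ?case
      using norm_triangle_ineq[of "\<phi> (e * x * e) - \<phi> (e * (x * a))" "\<phi> (e * (x * a)) - \<phi> (x * a)"]
      by simp
  qed
qed

text \<open>The elements \<open>a n\<close> are chosen from \<open>\<phi>\<close> alone, so the
  limit of \<open>\<phi> (x * a n)\<close> is the same number for every approximate
  identity.\<close>

lemma state_host_limit:
  assumes L: "cstar_subalgebra L" "closed_two_sided_ideal L" and \<phi>: "\<phi> \<in> state_space L"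
  shows "\<exists>z. \<forall>G. approximate_identity L G \<longrightarrow> ((\<lambda>e. \<phi> (e * x * e)) \<longlongrightarrow> z) G"
proof (cases "\<exists>G. approximate_identity L G")
  case True
  then obtain G\<^sub>0 where G\<^sub>0: "approximate_identity L G\<^sub>0" by blast
  define \<epsilon> where "\<epsilon> n = inverse (real (Suc n))" for n
  define \<delta> where "\<delta> n = norm x * sqrt (4 * \<epsilon> n) + \<epsilon> n" for n
  have \<epsilon>: "\<epsilon> n > 0" for n by (simp add: \<epsilon>_def)
  have \<epsilon>0: "\<epsilon> \<longlonglongrightarrow> 0" unfolding \<epsilon>_def by (rule LIMSEQ_inverse_real_of_nat)
  have "\<delta> \<longlonglongrightarrow> norm x * sqrt (4 * 0) + 0" unfolding \<delta>_def by (intro tendsto_intros \<epsilon>0)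
  then have \<delta>: "\<delta> \<longlonglongrightarrow> 0" by simp
  obtain a where a: "\<And>n. a n \<in> L" "\<And>n. norm (a n) \<le> 1" "\<And>n. Re (\<phi> (a n)) > 1 - \<epsilon> n"
    using state_near_one[OF L(1) \<phi> \<epsilon>] by metis
  have est: "\<forall>\<^sub>F e in G. cmod (\<phi> (e * x * e) - \<phi> (x * a n)) \<le> \<delta> n"
    if "approximate_identity L G" for G n
    using state_host_estimate[OF L \<phi> that \<epsilon> a] by (simp add: \<delta>_def)
  \<comment> \<open>Both values are compared with \<open>\<phi> (e * x * e)\<close> for a single
    \<open>e\<close> occurring in \<open>G\<^sub>0\<close>.\<close>
  have cauchy: "cmod (\<phi> (x * a m) - \<phi> (x * a n)) \<le> \<delta> m + \<delta> n" for m n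
  proof -
    obtain e where "cmod (\<phi> (e * x * e) - \<phi> (x * a m)) \<le> \<delta> m"
      "cmod (\<phi> (e * x * e) - \<phi> (x * a n)) \<le> \<delta> n"
      using eventually_happens'[OF approximate_identityD(1)[OF G\<^sub>0]
          eventually_conj[OF est[OF G\<^sub>0, of m] est[OF G\<^sub>0, of n]]] by blast
    then show ?thesis
      using norm_triangle_ineq4[of "\<phi> (e * x * e) - \<phi> (x * a n)" "\<phi> (e * x * e) - \<phi> (x * a m)"]
      by simp
  qed
  have "Cauchy (\<lambda>n. \<phi> (x * a n))"
  proof (rule CauchyI)
    fix r :: real assume "r > 0"
    then have "\<forall>\<^sub>F n in sequentially. \<delta> n < r / 2"
      using order_tendstoD(2)[OF \<delta>, of "r / 2"] by simp
    then obtain N where N: "\<And>n. n \<ge> N \<Longrightarrow> \<delta> n < r / 2" by (auto simp: eventually_sequentially)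
    have "cmod (\<phi> (x * a m) - \<phi> (x * a n)) < r" if "m \<ge> N" "n \<ge> N" for m n
      using cauchy[of m n] N[OF that(1)] N[OF that(2)] by linarith
    then show "\<exists>M. \<forall>m\<ge>M. \<forall>n\<ge>M. cmod (\<phi> (x * a m) - \<phi> (x * a n)) < r" by blast
  qed
  then obtain z where z: "(\<lambda>n. \<phi> (x * a n)) \<longlonglongrightarrow> z"
    using Cauchy_convergent_iff convergent_def by blast
  have "cmod (z - \<phi> (x * a n)) \<le> \<delta> n" for n
  proof (rule tendsto_le[OF sequentially_bot])
    show "(\<lambda>m. cmod (\<phi> (x * a m) - \<phi> (x * a n))) \<longlonglongrightarrow> cmod (z - \<phi> (x * a n))"
      by (intro tendsto_intros z)
    show "(\<lambda>m. \<delta> m + \<delta> n) \<longlonglongrightarrow> \<delta> n" using tendsto_add[OF \<delta> tendsto_const, of "\<delta> n"] by simp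
  qed (use cauchy in auto)
  note z_near = this
  have "((\<lambda>e. \<phi> (e * x * e)) \<longlongrightarrow> z) G" if G: "approximate_identity L G" for G
  proof (rule tendstoI)
    fix r :: real assume "r > 0"
    then have "\<forall>\<^sub>F n in sequentially. \<delta> n < r / 2"
      using order_tendstoD(2)[OF \<delta>, of "r / 2"] by simp
    then obtain n where n: "\<delta> n < r / 2" using eventually_happens'[OF sequentially_bot] by blast
    show "\<forall>\<^sub>F e in G. dist (\<phi> (e * x * e)) z < r"
      using est[OF G, of n]
    proof eventually_elim
      case (elim e)
      then show ?case
        using norm_triangle_ineq4[of "\<phi> (e * x * e) - \<phi> (x * a n)" "z - \<phi> (x * a n)"] z_near[of n] n
        by (simp add: dist_norm)
    qed
  qed
  then show ?thesis by blast
qed auto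

text \<open>Existence of one approximate identity makes the limit unique, so the description in
  \<open>host_map\<close> denotes it.\<close>

lemma host_map_tendsto:
  assumes L: "cstar_subalgebra L" "closed_two_sided_ideal L" and \<phi>: "\<phi> \<in> state_space L"
    and G: "approximate_identity L G"
  shows "((\<lambda>e. \<phi> (e * \<xi> a * e)) \<longlongrightarrow> host_map L \<xi> \<phi> a) G"
proof -
  obtain z where z: "\<forall>G. approximate_identity L G \<longrightarrow> ((\<lambda>e. \<phi> (e * \<xi> a * e)) \<longlongrightarrow> z) G"
    using state_host_limit[OF L \<phi>] by blast
  have "host_map L \<xi> \<phi> a = z"
    unfolding host_map_def
  proof (rule the_equality)
    show "\<forall>G. approximate_identity L G \<longrightarrow> ((\<lambda>e. \<phi> (e * \<xi> a * e)) \<longlongrightarrow> z) G" by (rule z)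
    fix y assume "\<forall>G. approximate_identity L G \<longrightarrow> ((\<lambda>e. \<phi> (e * \<xi> a * e)) \<longlongrightarrow> y) G"
    then show "y = z" using z G approximate_identityD(1)[OF G] tendsto_unique by blast
  qed
  then show ?thesis using z G by simp
qed

lemma host_map_mix:
  assumes L: "cstar_subalgebra L" "closed_two_sided_ideal L" and G: "approximate_identity L G"
    and \<phi>: "\<phi> \<in> state_space L" and \<psi>: "\<psi> \<in> state_space L" and t: "0 \<le> t" "t \<le> 1"
  shows "host_map L \<xi> (mix t \<phi> \<psi>) = mix t (host_map L \<xi> \<phi>) (host_map L \<xi> \<psi>)"
proof
  fix a
  have "((\<lambda>e. mix t \<phi> \<psi> (e * \<xi> a * e)) \<longlongrightarrow> mix t (host_map L \<xi> \<phi>) (host_map L \<xi> \<psi>) a) G"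
    unfolding mix_def
    by (intro tendsto_intros host_map_tendsto[OF L \<phi> G] host_map_tendsto[OF L \<psi> G])
  with host_map_tendsto[OF L mix_state_space[OF L(1) G \<phi> \<psi> t] G]
  show "host_map L \<xi> (mix t \<phi> \<psi>) a = mix t (host_map L \<xi> \<phi>) (host_map L \<xi> \<psi>) a"
    by (rule tendsto_unique[OF approximate_identityD(1)[OF G]])
qed

text \<open>The value at 0 forces \<open>k = 0\<close>, and the zero functional does not have norm
  one.\<close>

lemma state_not_constant:
  assumes "\<omega> \<in> state_space UNIV"
  shows "\<omega> \<noteq> (\<lambda>a. k)"
proof
  assume const: "\<omega> = (\<lambda>a. k)"
  have q: "\<omega> \<in> quasi_states UNIV" "functional_norm UNIV \<omega> = 1"
    using assms state_space_quasi[OF cstar_subalgebra_UNIV] by auto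
  have "cmod k \<le> 0" using quasi_statesD(5)[OF q(1), of 0] by (simp add: const)
  then have "functional_norm UNIV \<omega> \<le> 0" by (intro functional_norm_least) (auto simp: const)
  then show False using q(2) by simp
qed

text \<open>Without an approximate identity the description in \<open>host_map\<close> would be vacuous and
  \<open>host_map L \<xi> \<sigma>\<close> a constant function, so the nonempty range of states provides one.\<close>

lemma ideal_host_extremal_state:
  assumes S: "S \<noteq> {}" "S \<subseteq> state_space UNIV" and host: "ideal_host L S"
  shows "\<exists>\<omega>. extremal_in S \<omega>"
proof -
  obtain \<xi> where L: "cstar_subalgebra L" "closed_two_sided_ideal L"
    and inj: "inj_on (host_map L \<xi>) (state_space L)" and range: "host_map L \<xi> ` state_space L = S"
    using host unfolding ideal_host_def by blast
  obtain G where G: "approximate_identity L G"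
  proof -
    obtain \<sigma> where "host_map L \<xi> \<sigma> \<in> state_space UNIV" using S range by blast
    then have "host_map L \<xi> \<sigma> \<noteq> (\<lambda>a. THE z. True)" by (rule state_not_constant)
    then have "\<exists>G. approximate_identity L G" unfolding host_map_def by force
    then show ?thesis using that by blast
  qed
  have "state_space L \<noteq> {}" using S(1) range by blast
  then obtain \<rho> where \<rho>: "extremal_in (state_space L) \<rho>" using pure_state_exists[OF L(1)] by blast
  then have \<rho>S: "\<rho> \<in> state_space L" by (simp add: extremal_in_def)
  have "extremal_in S (host_map L \<xi> \<rho>)"
    unfolding extremal_in_def
  proof (intro conjI ballI impI)
    show "host_map L \<xi> \<rho> \<in> S" using \<rho>S range by blast
    fix \<phi> \<psi> :: "'a \<Rightarrow> complex" and t :: real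
    assume *: "\<phi> \<in> S" "\<psi> \<in> S" and t: "t \<in> {0<..<1}" and eq: "host_map L \<xi> \<rho> = mix t \<phi> \<psi>"
    obtain \<phi>' where \<phi>': "\<phi>' \<in> state_space L" "\<phi> = host_map L \<xi> \<phi>'" using *(1) range by blast
    obtain \<psi>' where \<psi>': "\<psi>' \<in> state_space L" "\<psi> = host_map L \<xi> \<psi>'" using *(2) range by blast
    have t': "0 \<le> t" "t \<le> 1" using t by auto
    \<comment> \<open>Affinity lifts the decomposition to \<open>L\<close>; injectivity then makes
      it a decomposition of \<open>\<rho>\<close>.\<close>
    have "host_map L \<xi> \<rho> = host_map L \<xi> (mix t \<phi>' \<psi>')"
      using host_map_mix[OF L G \<phi>'(1) \<psi>'(1) t', of \<xi>] eq \<phi>'(2) \<psi>'(2) by simp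
    then have "\<rho> = mix t \<phi>' \<psi>'"
      using inj_onD[OF inj] \<rho>S mix_state_space[OF L(1) G \<phi>'(1) \<psi>'(1) t'] by blast
    then have "\<phi>' = \<rho>" "\<psi>' = \<rho>" using \<rho> \<phi>'(1) \<psi>'(1) t by (auto simp: extremal_in_def)
    then show "\<phi> = host_map L \<xi> \<rho>" "\<psi> = host_map L \<xi> \<rho>" using \<phi>'(2) \<psi>'(2) by simp_all
  qed
  then show ?thesis by blast
qed

section \<open>Inner products and selfadjoint operators\<close>

lemma cinner_add_left: "cinner (x + y) z = cinner x z + cinner y (z::'h::chilbert_space)"
  by (metis cinner_add_right cinner_commute complex_cnj_add)

lemma cinner_scaleC_left: "cinner (c *\<^sub>C x) z = cnj c * cinner x (z::'h::chilbert_space)"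
  by (metis cinner_commute cinner_scaleC_right complex_cnj_mult)

lemma cinner_diff_right: "cinner x (y - z) = cinner x y - cinner x (z::'h::chilbert_space)"
  using cinner_add_right[of x y "(-1) *\<^sub>C z"] cinner_scaleC_right[of x "-1" z]
  by (simp add: scaleC_minus_one)

lemma cinner_diff_left: "cinner (x - y) z = cinner x z - cinner y (z::'h::chilbert_space)"
  using cinner_add_left[of x "(-1) *\<^sub>C y" z] cinner_scaleC_left[of "-1" y z]
  by (simp add: scaleC_minus_one)

lemma cinner_Cauchy_Schwarz:
  fixes x y :: "'h::chilbert_space"
  shows "cmod (cinner x y) \<le> norm x * norm y"
proof (cases "x = 0")
  case True
  then show ?thesis using cinner_diff_left[of x x y] by simp
next
  case False
  define s where "s = cinner x y"
  define N where "N = (norm x)\<^sup>2"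
  have N: "N > 0" using False by (simp add: N_def)
  have yx: "cinner y x = cnj s" by (simp add: s_def cinner_commute[of y x])
  have ss: "s * cnj s = of_real ((cmod s)\<^sup>2)" by (rule complex_norm_square[symmetric])
  \<comment> \<open>The coefficient of the orthogonal projection of \<open>y\<close> onto
    \<open>x\<close>; the inequality says that the remainder has nonnegative squared norm.\<close>
  define c where "c = s / of_real N"
  have "of_real ((norm (y - c *\<^sub>C x))\<^sup>2) = cinner (y - c *\<^sub>C x) (y - c *\<^sub>C x)"
    by (rule cinner_same[symmetric])
  also have "\<dots> = of_real ((norm y)\<^sup>2) - c * cnj s - cnj c * s + cnj c * c * of_real N"
    by (simp only: cinner_diff_left cinner_diff_right cinner_scaleC_left cinner_scaleC_right
        cinner_same[of x] cinner_same[of y] yx N_def flip: s_def) (simp add: algebra_simps)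
  also have "\<dots> = of_real ((norm y)\<^sup>2) - s * cnj s / of_real N"
    using N by (simp add: c_def mult.commute)
  also have "\<dots> = of_real ((norm y)\<^sup>2 - (cmod s)\<^sup>2 / N)" unfolding ss by simp
  finally have "(norm (y - c *\<^sub>C x))\<^sup>2 = (norm y)\<^sup>2 - (cmod s)\<^sup>2 / N"
    by (simp only: of_real_eq_iff)
  then have "(cmod s)\<^sup>2 / N \<le> (norm y)\<^sup>2" using zero_le_power2[of "norm (y - c *\<^sub>C x)"] by linarith
  then have "(cmod s)\<^sup>2 \<le> (norm x * norm y)\<^sup>2"
    using N by (simp add: field_simps N_def)
  then show ?thesis unfolding s_def by (rule power2_le_imp_le) simp
qed

lemma bounded_bilinear_cinner: "bounded_bilinear (cinner :: 'h::chilbert_space \<Rightarrow> 'h \<Rightarrow> complex)"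
proof
  show "\<exists>K. \<forall>a b::'h. cmod (cinner a b) \<le> norm a * norm b * K"
    by (intro exI[of _ 1]) (simp add: cinner_Cauchy_Schwarz)
qed (simp_all add: cinner_add_left cinner_add_right cinner_scaleC_left cinner_scaleC_right
    scaleR_conv_of_real flip: scaleC_of_real)

lemmas tendsto_cinner = bounded_bilinear.tendsto[OF bounded_bilinear_cinner]

lemma scaleC_diff_right: "c *\<^sub>C (x - y) = c *\<^sub>C x - c *\<^sub>C (y::'a::complex_normed_vector)"
  using scaleC_add_right[of c x "(-1) *\<^sub>C y"] scaleC_scaleC[of c "-1" y] scaleC_scaleC[of "-1" c y]
  by (simp add: scaleC_minus_one)

lemma scaleC_diff_left: "(c - d) *\<^sub>C x = c *\<^sub>C x - d *\<^sub>C (x::'a::complex_normed_vector)"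
  using scaleC_add_left[of c "- d" x] scaleC_scaleC[of "-1" d x] by (simp add: scaleC_minus_one)

lemma scaleC_zero_right [simp]: "c *\<^sub>C 0 = (0::'a::complex_normed_vector)"
  using scaleC_diff_right[of c 0 0] by simp

lemma cinner_zero [simp]: "cinner x 0 = 0" "cinner 0 (x::'h::chilbert_space) = 0"
  using cinner_diff_right[of x x x] cinner_diff_left[of x x x] by simp_all

lemma complex_subspaceD:
  assumes "complex_subspace H"
  shows "0 \<in> H" "x \<in> H \<Longrightarrow> y \<in> H \<Longrightarrow> x + y \<in> H" "x \<in> H \<Longrightarrow> c *\<^sub>C x \<in> H"
    "x \<in> H \<Longrightarrow> y \<in> H \<Longrightarrow> x - y \<in> H"
proof -
  show *: "0 \<in> H" "x \<in> H \<Longrightarrow> y \<in> H \<Longrightarrow> x + y \<in> H" "x \<in> H \<Longrightarrow> c *\<^sub>C x \<in> H"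
    for x y c using assms by (auto simp: complex_subspace_def)
  show "x \<in> H \<Longrightarrow> y \<in> H \<Longrightarrow> x - y \<in> H"
    using *(2)[of x "(-1) *\<^sub>C y"] *(3)[of y "-1"] by (simp add: scaleC_minus_one)
qed

section \<open>Bounded selfadjoint operators and the square root iteration\<close>

definition linear_op :: "'h::chilbert_space set \<Rightarrow> ('h \<Rightarrow> 'h) \<Rightarrow> bool" where
  "linear_op H A \<longleftrightarrow> (\<forall>x\<in>H. A x \<in> H) \<and> (\<forall>x\<in>H. \<forall>y\<in>H. A (x + y) = A x + A y) \<and>
     (\<forall>c. \<forall>x\<in>H. A (c *\<^sub>C x) = c *\<^sub>C A x)"

text \<open>As in \<open>linear_op\<close>, and unlike \<open>bounded_operators\<close>, values
  outside \<open>H\<close> are left free, so sums and compositions stay in the class without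
  \<open>restrict\<close>.\<close>

definition selfadjoint_op :: "'h::chilbert_space set \<Rightarrow> real \<Rightarrow> ('h \<Rightarrow> 'h) \<Rightarrow> bool" where
  "selfadjoint_op H K A \<longleftrightarrow> linear_op H A \<and> (\<forall>x\<in>H. norm (A x) \<le> K * norm x) \<and>
     (\<forall>x\<in>H. \<forall>y\<in>H. cinner (A x) y = cinner x (A y))"

definition commutes_on :: "'h set \<Rightarrow> ('h \<Rightarrow> 'h) \<Rightarrow> ('h \<Rightarrow> 'h) \<Rightarrow> bool" where
  "commutes_on H A B \<longleftrightarrow> (\<forall>x\<in>H. A (B x) = B (A x))"

lemma linear_opD:
  assumes "linear_op H A" "x \<in> H"
  shows "A x \<in> H" "y \<in> H \<Longrightarrow> A (x + y) = A x + A y" "A (c *\<^sub>C x) = c *\<^sub>C A x"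
    "complex_subspace H \<Longrightarrow> y \<in> H \<Longrightarrow> A (x - y) = A x - A y"
proof -
  show *: "A x \<in> H" "y \<in> H \<Longrightarrow> A (x + y) = A x + A y" "A (c *\<^sub>C x) = c *\<^sub>C A x" for y c
    using assms by (auto simp: linear_op_def)
  assume H: "complex_subspace H" and y: "y \<in> H"
  have "A ((-1) *\<^sub>C y) = (-1) *\<^sub>C A y" using assms(1) y unfolding linear_op_def by blast
  then show "A (x - y) = A x - A y"
    using *(2)[OF complex_subspaceD(3)[OF H y], of "-1"] by (simp add: scaleC_minus_one)
qed

lemma selfadjoint_opD:
  assumes "selfadjoint_op H K A"
  shows "linear_op H A" "x \<in> H \<Longrightarrow> norm (A x) \<le> K * norm x"
    "x \<in> H \<Longrightarrow> y \<in> H \<Longrightarrow> cinner (A x) y = cinner x (A y)"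
  using assms by (auto simp: selfadjoint_op_def)

text \<open>The limit is \<open>1 - sqrt (1 - A\<^sup>2)\<close>, the fixed point of \<open>y \<mapsto> (A\<^sup>2 + y\<^sup>2) / 2\<close>.\<close>

primrec sqrt_iter :: "('h::chilbert_space \<Rightarrow> 'h) \<Rightarrow> nat \<Rightarrow> 'h \<Rightarrow> 'h" where
  "sqrt_iter A 0 = (\<lambda>x. 0)"
| "sqrt_iter A (Suc n) = (\<lambda>x. (1/2) *\<^sub>C (A (A x) + sqrt_iter A n (sqrt_iter A n x)))"

text \<open>The bound 1/2 reproduces itself: the two squares have bound 1/4 each, and their sum is
  halved. Selfadjointness passes to squares and real combinations.\<close>

lemma selfadjoint_sqrt_iter:
  assumes H: "complex_subspace H" and A: "selfadjoint_op H (1/2) A"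
  shows "selfadjoint_op H (1/2) (sqrt_iter A n)"
proof (induction n)
  case 0
  show ?case by (simp add: selfadjoint_op_def linear_op_def complex_subspaceD(1)[OF H])
next
  case (Suc n)
  note a = linear_opD[OF selfadjoint_opD(1)[OF A]] selfadjoint_opD(2-3)[OF A]
  note y = linear_opD[OF selfadjoint_opD(1)[OF Suc]] selfadjoint_opD(2-3)[OF Suc]
  let ?y = "sqrt_iter A n" and ?z = "sqrt_iter A (Suc n)"
  have "linear_op H ?z"
    unfolding linear_op_def
  proof (intro conjI ballI allI)
    fix x w c assume x: "x \<in> H" and w: "w \<in> H"
    show "?z x \<in> H" using x by (simp add: a(1) y(1) complex_subspaceD(2,3)[OF H])
    show "?z (x + w) = ?z x + ?z w"
      using x w by (simp add: a(1,2) y(1,2) scaleC_add_right algebra_simps)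
    show "?z (c *\<^sub>C x) = c *\<^sub>C ?z x"
      using x by (simp add: a(1,3) y(1,3) scaleC_add_right scaleC_scaleC mult.commute)
  qed
  moreover have "norm (?z x) \<le> 1/2 * norm x" if x: "x \<in> H" for x
  proof -
    have "norm (A (A x)) \<le> 1/4 * norm x" "norm (?y (?y x)) \<le> 1/4 * norm x"
      using a(5)[OF x] a(5)[OF a(1)[OF x]] y(5)[OF x] y(5)[OF y(1)[OF x]] by linarith+
    then have "norm (A (A x) + ?y (?y x)) \<le> norm x"
      using norm_triangle_ineq[of "A (A x)" "?y (?y x)"] norm_ge_zero[of x] by linarith
    then show ?thesis by (simp add: norm_scaleC norm_divide)
  qed
  moreover have "cinner (?z x) w = cinner x (?z w)" if x: "x \<in> H" and w: "w \<in> H" for x w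
    using a(6)[OF a(1)[OF x] w] a(6)[OF x a(1)[OF w]] y(6)[OF y(1)[OF x] w] y(6)[OF x y(1)[OF w]]
    by (simp add: cinner_scaleC_left cinner_scaleC_right cinner_add_left cinner_add_right)
  ultimately show ?case unfolding selfadjoint_op_def by blast
qed

text \<open>Each iterate is a polynomial in \<open>A\<close>. The lemma serves both for
  \<open>B = \<pi> a\<close> and for showing that the iterates commute with one another.\<close>

lemma commutes_sqrt_iter:
  assumes H: "complex_subspace H" and A: "selfadjoint_op H (1/2) A" and B: "linear_op H B"
    and com: "commutes_on H A B"
  shows "commutes_on H (sqrt_iter A n) B"
proof (induction n)
  case 0
  have "B 0 = 0" using linear_opD(3)[OF B complex_subspaceD(1)[OF H], of 0] by simp
  then show ?case by (simp add: commutes_on_def)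
next
  case (Suc n)
  note y = linear_opD(1)[OF selfadjoint_opD(1)[OF selfadjoint_sqrt_iter[OF H A]]]
  note a = linear_opD(1)[OF selfadjoint_opD(1)[OF A]]
  show ?case
    using com Suc by (simp add: commutes_on_def linear_opD(2,3)[OF B] y a complex_subspaceD(2)[OF H])
qed

text \<open>For commuting \<open>?y\<close> and \<open>?z\<close> the difference of squares is the
  sum applied to \<open>d\<close>. Both operators have bound 1/2, so the sum does not enlarge
  \<open>d\<close>, and the factor 1/2 of the iteration halves it.\<close>

lemma sqrt_iter_diff:
  assumes H: "complex_subspace H" and A: "selfadjoint_op H (1/2) A" and x: "x \<in> H"
  shows "norm (sqrt_iter A (Suc n) x - sqrt_iter A n x) \<le> (1/2) ^ n * norm x"
proof (induction n)
  case 0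
  have "norm (A (A x)) \<le> 1/2 * (1/2 * norm x)"
    using selfadjoint_opD(2)[OF A x] selfadjoint_opD(2)[OF A linear_opD(1)[OF selfadjoint_opD(1)[OF A] x]]
    by linarith
  then have "norm (A (A x)) \<le> 2 * norm x" using norm_ge_zero[of x] by linarith
  then show ?case by (simp add: norm_scaleC norm_divide)
next
  case (Suc n)
  let ?y = "sqrt_iter A n" and ?z = "sqrt_iter A (Suc n)"
  note sa = selfadjoint_sqrt_iter[OF H A]
  note lin = selfadjoint_opD(1)[OF sa]
  \<comment> \<open>Commutation of two iterates is obtained in two stages: \<open>?y\<close> with
    \<open>A\<close>, and from that \<open>?z\<close> with \<open>?y\<close>.\<close>
  have "commutes_on H A A" by (simp add: commutes_on_def)
  then have "commutes_on H ?y A" by (rule commutes_sqrt_iter[OF H A selfadjoint_opD(1)[OF A]])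
  then have "commutes_on H A ?y" by (simp add: commutes_on_def)
  then have "commutes_on H ?z ?y" by (rule commutes_sqrt_iter[OF H A lin])
  then have com: "?z (?y x) = ?y (?z x)" using x unfolding commutes_on_def by blast
  have m: "?y x \<in> H" "?z x \<in> H" using linear_opD(1)[OF lin x] by blast+
  define d where "d = ?z x - ?y x"
  have d: "d \<in> H" unfolding d_def using complex_subspaceD(4)[OF H m(2,1)] .
  have "?z (?z x) - ?y (?y x) = ?z d + ?y d"
    unfolding d_def linear_opD(4)[OF lin m(2) H m(1)] com by simp
  moreover have "sqrt_iter A (Suc (Suc n)) x - ?z x = (1/2) *\<^sub>C (?z (?z x) - ?y (?y x))"
  proof -
    have "sqrt_iter A (Suc (Suc n)) x = (1/2) *\<^sub>C (A (A x) + ?z (?z x))"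
      by (rule fun_cong[OF sqrt_iter.simps(2)])
    moreover have "?z x = (1/2) *\<^sub>C (A (A x) + ?y (?y x))"
      by (rule fun_cong[OF sqrt_iter.simps(2)])
    ultimately show ?thesis by (simp only: flip: scaleC_diff_right) simp
  qed
  ultimately have "norm (sqrt_iter A (Suc (Suc n)) x - ?z x) = 1/2 * norm (?z d + ?y d)"
    by (simp only: norm_scaleC) (simp add: norm_divide)
  also have "norm (?z d + ?y d) \<le> norm (?z d) + norm (?y d)" by (rule norm_triangle_ineq)
  also have "norm (?z d) + norm (?y d) \<le> norm d"
    using selfadjoint_opD(2)[OF sa[of "Suc n"] d] selfadjoint_opD(2)[OF sa[of n] d] by linarith
  also have "norm d \<le> (1/2) ^ n * norm x" using Suc unfolding d_def .
  finally show ?case by simp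
qed

lemma sqrt_iter_converges:
  assumes H: "complex_subspace H" "closed H" and A: "selfadjoint_op H (1/2) A" and x: "x \<in> H"
  shows "\<exists>y\<in>H. (\<lambda>n. sqrt_iter A n x) \<longlonglongrightarrow> y"
proof -
  let ?d = "\<lambda>n. sqrt_iter A (Suc n) x - sqrt_iter A n x"
  have "summable (\<lambda>n. (1/2) ^ n * norm x :: real)"
    by (intro summable_mult2 summable_geometric) simp
  then have "summable ?d"
    by (rule summable_comparison_test') (use sqrt_iter_diff[OF H(1) A x] in blast)
  then have "(\<lambda>n. \<Sum>i<n. ?d i) \<longlonglongrightarrow> suminf ?d" by (rule summable_LIMSEQ)
  moreover have "(\<Sum>i<n. ?d i) = sqrt_iter A n x" for n
    using sum_lessThan_telescope[of "\<lambda>n. sqrt_iter A n x" n] by simp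
  ultimately have "(\<lambda>n. sqrt_iter A n x) \<longlonglongrightarrow> suminf ?d" by simp
  moreover have "sqrt_iter A n x \<in> H" for n
    using linear_opD(1)[OF selfadjoint_opD(1)[OF selfadjoint_sqrt_iter[OF H(1) A]] x] .
  ultimately show ?thesis using closed_sequentially[OF H(2), of "\<lambda>n. sqrt_iter A n x"] by blast
qed

section \<open>GNS representations\<close>

lemma star_one [simp]: "star 1 = (1::'a::cstar_algebra_1)"
  by (metis mult.left_neutral mult.right_neutral star_mult star_star)

text \<open>States are defined by their norm. Cauchy-Schwarz with \<open>b = 1\<close> bounds the
  squared modulus of \<open>\<omega> a\<close> by \<open>\<omega> 1\<close> for \<open>a\<close> in
  the unit ball, and such values come close to 1.\<close>

lemma state_at_one:
  assumes "\<omega> \<in> state_space UNIV"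
  shows "\<omega> 1 = 1"
proof -
  have q: "\<omega> \<in> quasi_states UNIV" using assms state_space_quasi[OF cstar_subalgebra_UNIV] by blast
  have le: "Re (\<omega> 1) \<le> 1"
    using quasi_statesD(5)[OF q, of 1] complex_Re_le_cmod[of "\<omega> 1"] by simp
  have "1 - \<epsilon> \<le> Re (\<omega> 1)" if \<epsilon>: "0 < \<epsilon>" "\<epsilon> < 1" for \<epsilon>
  proof -
    obtain a where a: "norm a \<le> 1" "Re (\<omega> a) > 1 - \<epsilon> / 2"
      using state_near_one[OF cstar_subalgebra_UNIV assms, of "\<epsilon> / 2"] \<epsilon> by auto
    have "cmod (\<omega> (star a * a)) \<le> norm (star a * a)" using quasi_statesD(5)[OF q] by blast
    also have "\<dots> \<le> 1" using a(1) by (simp add: cstar_identity power_le_one)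
    finally have aa: "Re (\<omega> (star a * a)) \<le> 1"
      using complex_Re_le_cmod[of "\<omega> (star a * a)"] by linarith
    have "1 - \<epsilon> \<le> (1 - \<epsilon> / 2)\<^sup>2" by (simp add: power2_eq_square algebra_simps)
    also have "\<dots> \<le> (cmod (\<omega> a))\<^sup>2"
      using a(2) complex_Re_le_cmod[of "\<omega> a"] \<epsilon> by (intro power_mono) auto
    also have "\<dots> \<le> Re (\<omega> (star a * a)) * Re (\<omega> 1)"
      using quasi_state_Cauchy_Schwarz[OF cstar_subalgebra_UNIV q, of a 1] by simp
    also have "\<dots> \<le> 1 * Re (\<omega> 1)"
      using aa quasi_statesD(3)[OF q, of 1] by (intro mult_right_mono) auto
    finally show ?thesis by simp
  qed
  then have "1 - Re (\<omega> 1) \<le> \<epsilon>" if "0 < \<epsilon>" "\<epsilon> < 1" for \<epsilon> using that by force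
  then have "1 - Re (\<omega> 1) \<le> 0"
    by (metis dense_ge_bounded zero_less_one)
  then have "Re (\<omega> 1) = 1" using le by simp
  then show ?thesis using quasi_statesD(4)[OF q, of 1] by (simp add: complex_eq_iff)
qed

text \<open>After normalisation, conjugation by \<open>b\<close> yields a member of
  \<open>S\<close>, which is a state and hence contractive. This takes the place of the order
  inequality between \<open>star b * a * b\<close> and \<open>norm a\<close> times
  \<open>star b * b\<close>.\<close>

lemma folium_conjugation_bound:
  assumes S: "folium S" and \<omega>: "\<omega> \<in> S"
  shows "cmod (\<omega> (star b * a * b)) \<le> norm a * Re (\<omega> (star b * b))"
proof -
  have q: "\<psi> \<in> quasi_states UNIV" if "\<psi> \<in> S" for \<psi>
    using S that state_space_quasi[OF cstar_subalgebra_UNIV] unfolding folium_def by blast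
  note lin = quasi_statesD[OF q[OF \<omega>]]
  define r where "r = Re (\<omega> (star b * b))"
  have r: "\<omega> (star b * b) = of_real r" "r \<ge> 0"
    using lin(3,4)[of b] by (simp_all add: r_def complex_eq_iff)
  show ?thesis
  proof (cases "r = 0")
    \<comment> \<open>Here \<open>b\<close> cannot be normalised, but Cauchy-Schwarz makes the left
      side vanish.\<close>
    case True
    have "(cmod (\<omega> (star b * (a * b))))\<^sup>2 \<le> 0"
      using quasi_state_Cauchy_Schwarz[OF cstar_subalgebra_UNIV q[OF \<omega>], of "a * b" b] True
      by (simp add: r_def)
    then show ?thesis using True by (simp add: r_def mult.assoc)
  next
    case False
    define c where "c = complex_of_real (1 / sqrt r)"
    have c: "cnj c * c = of_real (1 / r)"
      using r(2) by (simp add: c_def flip: of_real_mult)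
    have scale: "\<omega> (star (c *\<^sub>C b) * x * (c *\<^sub>C b)) = of_real (1 / r) * \<omega> (star b * x * b)" for x
    proof -
      have "star (c *\<^sub>C b) * x * (c *\<^sub>C b) = (cnj c * c) *\<^sub>C (star b * x * b)"
        by (simp add: star_scaleC mult_scaleC_left mult_scaleC_right scaleC_scaleC mult.commute)
      then show ?thesis by (simp only: lin(2) c UNIV_I)
    qed
    have "\<omega> (star (c *\<^sub>C b) * (c *\<^sub>C b)) = 1"
      using scale[of 1] r False by simp
    then have "(\<lambda>a. \<omega> (star (c *\<^sub>C b) * a * (c *\<^sub>C b))) \<in> S"
      using S \<omega> unfolding folium_def by blast
    from quasi_statesD(5)[OF q[OF this], of a] have "cmod (of_real (1 / r) * \<omega> (star b * a * b)) \<le> norm a"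
      unfolding scale by simp
    then have "cmod (\<omega> (star b * a * b)) / r \<le> norm a" using r(2) by (simp add: norm_mult norm_divide)
    then show ?thesis using r(2) False by (simp add: field_simps flip: r_def)
  qed
qed

section \<open>Vector states of the GNS representation of a member of a folium\<close>

locale gns_folium =
  fixes S :: "('f::cstar_algebra_1 \<Rightarrow> complex) set" and \<omega> :: "'f \<Rightarrow> complex"
    and H :: "'h::chilbert_space set" and \<pi> :: "'f \<Rightarrow> 'h \<Rightarrow> 'h" and \<Omega> :: 'h
  assumes S: "folium S" and \<omega>: "\<omega> \<in> S" and gns: "gns_representation \<omega> H \<pi> \<Omega>"
begin

lemma H: "complex_subspace H" "closed H" and \<Omega>: "\<Omega> \<in> H"
  and cyclic: "closure (range (\<lambda>a. \<pi> a \<Omega>)) = H" and \<omega>_eq: "\<omega> a = cinner \<Omega> (\<pi> a \<Omega>)"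
  using gns by (simp_all add: gns_representation_def)

lemmas subH = complex_subspaceD[OF H(1)]

lemma rep: "star_representation H \<pi>"
  using gns by (simp add: gns_representation_def)

lemma bounded_\<pi>: "\<pi> a \<in> bounded_operators H"
  using rep unfolding star_representation_def by blast

lemma linear_\<pi>: "linear_op H (\<pi> a)"
  using bounded_\<pi>[of a] by (auto simp: bounded_operators_def linear_op_def)

lemma \<pi>_mem: "x \<in> H \<Longrightarrow> \<pi> a x \<in> H"
  by (rule linear_opD(1)[OF linear_\<pi>])

lemma \<pi>_add: "x \<in> H \<Longrightarrow> \<pi> (a + b) x = \<pi> a x + \<pi> b x"
  and \<pi>_scaleC: "x \<in> H \<Longrightarrow> \<pi> (c *\<^sub>C a) x = c *\<^sub>C \<pi> a x"
  and \<pi>_mult: "x \<in> H \<Longrightarrow> \<pi> (a * b) x = \<pi> a (\<pi> b x)"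
  using rep by (simp_all add: star_representation_def)

lemma \<pi>_adjoint: "x \<in> H \<Longrightarrow> y \<in> H \<Longrightarrow> cinner (\<pi> (star a) x) y = cinner x (\<pi> a y)"
  using rep by (simp add: star_representation_def adjoint_on_def)

lemma cyclic_sequence:
  assumes "x \<in> H"
  obtains b where "(\<lambda>n. \<pi> (b n) \<Omega>) \<longlonglongrightarrow> x"
proof -
  have "x \<in> closure (range (\<lambda>a. \<pi> a \<Omega>))" using assms cyclic by simp
  then obtain f where f: "\<And>n. f n \<in> range (\<lambda>a. \<pi> a \<Omega>)" "f \<longlonglongrightarrow> x"
    unfolding closure_sequential by blast
  define b where "b n = (SOME a. f n = \<pi> a \<Omega>)" for n
  have "f n = \<pi> (b n) \<Omega>" for n
    unfolding b_def by (rule someI_ex) (use f(1)[of n] in blast)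
  then have "f = (\<lambda>n. \<pi> (b n) \<Omega>)" by (rule ext)
  with f(2) that show ?thesis by simp
qed

text \<open>Approximating \<open>z\<close> itself by cyclic vectors gives
  \<open>cinner z z = 0\<close>. Operator identities below are checked by matrix elements against
  cyclic vectors through this lemma.\<close>

lemma cyclic_orthogonal:
  assumes "z \<in> H" "\<And>b. cinner (\<pi> b \<Omega>) z = 0"
  shows "z = 0"
proof -
  obtain b where b: "(\<lambda>n. \<pi> (b n) \<Omega>) \<longlonglongrightarrow> z" using cyclic_sequence[OF assms(1)] .
  have "(\<lambda>n. cinner (\<pi> (b n) \<Omega>) z) \<longlonglongrightarrow> cinner z z" by (intro tendsto_cinner b tendsto_const)
  then have "cinner z z = 0" using assms(2) by (simp add: LIMSEQ_const_iff)
  then show ?thesis by (simp add: cinner_same)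
qed

lemma \<pi>_tendsto:
  assumes f: "f \<longlonglongrightarrow> x" and x: "x \<in> H" and mem: "\<And>n. f n \<in> H"
  shows "(\<lambda>n. \<pi> a (f n)) \<longlonglongrightarrow> \<pi> a x"
proof -
  obtain K where K: "\<forall>x\<in>H. norm (\<pi> a x) \<le> K * norm x"
    using bounded_\<pi>[of a] by (auto simp: bounded_operators_def)
  have "\<forall>\<^sub>F n in sequentially. norm (\<pi> a (f n) - \<pi> a x) \<le> K * norm (f n - x)"
  proof (rule always_eventually, rule allI)
    fix n
    show "norm (\<pi> a (f n) - \<pi> a x) \<le> K * norm (f n - x)"
      using K subH(4)[OF mem[of n] x] linear_opD(4)[OF linear_\<pi> mem[of n] H(1) x, of a] by metis
  qed
  moreover have "(\<lambda>n. K * norm (f n - x)) \<longlonglongrightarrow> 0"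
    by (intro tendsto_mult_right_zero tendsto_norm_zero LIM_zero f)
  ultimately have "(\<lambda>n. \<pi> a (f n) - \<pi> a x) \<longlonglongrightarrow> 0" by (rule Lim_null_comparison)
  then show ?thesis by (rule LIM_zero_cancel)
qed

text \<open>Unitality is a consequence of cyclicity: \<open>\<pi> 1 x - x\<close> is orthogonal to
  every \<open>\<pi> b \<Omega>\<close>.\<close>

lemma \<pi>_one:
  assumes x: "x \<in> H"
  shows "\<pi> 1 x = x"
proof -
  have mem: "\<pi> 1 x - x \<in> H" using subH(4)[OF \<pi>_mem[OF x] x] .
  have "cinner (\<pi> b \<Omega>) (\<pi> 1 x - x) = 0" for b
    using \<pi>_adjoint[OF \<pi>_mem[OF \<Omega>] x, of 1 b] \<pi>_mult[OF \<Omega>, of 1 b]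
    by (simp add: cinner_diff_right)
  then have "\<pi> 1 x - x = 0" by (rule cyclic_orthogonal[OF mem])
  then show ?thesis by simp
qed

lemma state: "\<omega> \<in> state_space UNIV"
  using S \<omega> unfolding folium_def by blast

lemma norm_\<Omega>: "norm \<Omega> = 1"
proof -
  have "of_real ((norm \<Omega>)\<^sup>2) = (1::complex)"
    using state_at_one[OF state] \<omega>_eq[of 1] \<pi>_one[OF \<Omega>] cinner_same[of \<Omega>] by simp
  then have "(norm \<Omega>)\<^sup>2 = 1" by (simp only: of_real_eq_1_iff)
  then show ?thesis by (simp add: power2_eq_1_iff) (metis norm_ge_zero not_one_le_zero neg_0_le_iff_le)
qed

text \<open>This identifies the conjugates of \<open>\<omega>\<close> from the folium condition with
  the functionals given by the cyclic vectors \<open>\<pi> b \<Omega>\<close>.\<close>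

lemma \<omega>_conjugation: "\<omega> (star b * a * b) = cinner (\<pi> b \<Omega>) (\<pi> a (\<pi> b \<Omega>))"
proof -
  have "\<omega> (star b * a * b) = cinner \<Omega> (\<pi> (star b) (\<pi> a (\<pi> b \<Omega>)))"
    by (simp add: \<omega>_eq \<pi>_mult \<Omega> \<pi>_mem)
  also have "\<dots> = cinner (\<pi> (star (star b)) \<Omega>) (\<pi> a (\<pi> b \<Omega>))"
    using \<pi>_adjoint[OF \<Omega> \<pi>_mem[OF \<pi>_mem[OF \<Omega>]], of "star b" a b] by simp
  finally show ?thesis by (simp add: star_star)
qed

lemma \<omega>_norm: "\<omega> (star b * b) = of_real ((norm (\<pi> b \<Omega>))\<^sup>2)"
  using \<omega>_conjugation[of b 1] \<pi>_one[OF \<pi>_mem[OF \<Omega>]] cinner_same[of "\<pi> b \<Omega>"] by simp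

text \<open>\<open>bounded_operators\<close> gives only a constant depending on \<open>a\<close>. On
  cyclic vectors the sharp bound is \<open>folium_conjugation_bound\<close> for
  \<open>star a * a\<close>; density does the rest.\<close>

lemma \<pi>_contractive:
  assumes x: "x \<in> H"
  shows "norm (\<pi> a x) \<le> norm a * norm x"
proof -
  obtain b where b: "(\<lambda>n. \<pi> (b n) \<Omega>) \<longlonglongrightarrow> x" using cyclic_sequence[OF x] .
  have "norm (\<pi> a (\<pi> b \<Omega>)) \<le> norm a * norm (\<pi> b \<Omega>)" for b
  proof (rule power2_le_imp_le)
    have "of_real ((norm (\<pi> a (\<pi> b \<Omega>)))\<^sup>2) = \<omega> (star b * (star a * a) * b)"
      using \<omega>_norm[of "a * b"] by (simp add: \<pi>_mult \<Omega> star_mult mult.assoc)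
    moreover have "cmod \<dots> \<le> norm (star a * a) * Re (\<omega> (star b * b))"
      by (rule folium_conjugation_bound[OF S \<omega>])
    ultimately have "cmod (of_real ((norm (\<pi> a (\<pi> b \<Omega>)))\<^sup>2)) \<le> (norm a)\<^sup>2 * (norm (\<pi> b \<Omega>))\<^sup>2"
      by (simp only: \<omega>_norm cstar_identity Re_complex_of_real)
    then show "(norm (\<pi> a (\<pi> b \<Omega>)))\<^sup>2 \<le> (norm a * norm (\<pi> b \<Omega>))\<^sup>2"
      by (simp add: power_mult_distrib norm_power)
  qed simp
  then show ?thesis
    using tendsto_le[OF sequentially_bot
        tendsto_mult[OF tendsto_const tendsto_norm[OF b]]
        tendsto_norm[OF \<pi>_tendsto[OF b x \<pi>_mem[OF \<Omega>], of a]]] by simp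
qed

definition vector_state :: "'h \<Rightarrow> 'f \<Rightarrow> complex" where
  "vector_state v = (\<lambda>a. cinner v (\<pi> a v))"

lemma vector_state_scaleC:
  "v \<in> H \<Longrightarrow> vector_state (c *\<^sub>C v) a = of_real ((cmod c)\<^sup>2) * vector_state v a"
  using linear_opD(3)[OF linear_\<pi>, of v a c]
  by (simp add: vector_state_def cinner_scaleC_left cinner_scaleC_right complex_norm_square
      del: of_real_power)

lemma vector_state_one: "v \<in> H \<Longrightarrow> vector_state v 1 = of_real ((norm v)\<^sup>2)"
  by (simp add: vector_state_def \<pi>_one cinner_same)

text \<open>Norm convergence of vectors becomes convergence in the functional norm, the norm in
  which folia are closed.\<close>

lemma vector_state_diff:
  assumes v: "v \<in> H" and w: "w \<in> H"
  shows "cmod (vector_state v a - vector_state w a) \<le> norm (v - w) * (norm v + norm w) * norm a"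
proof -
  have vw: "v - w \<in> H" using subH(4)[OF v w] .
  have "vector_state v a - vector_state w a = cinner (v - w) (\<pi> a v) + cinner w (\<pi> a (v - w))"
    by (simp add: vector_state_def linear_opD(4)[OF linear_\<pi> v H(1) w] cinner_diff_left
        cinner_diff_right)
  also have "cmod \<dots> \<le> norm (v - w) * norm (\<pi> a v) + norm w * norm (\<pi> a (v - w))"
    by (intro norm_triangle_le add_mono cinner_Cauchy_Schwarz)
  also have "\<dots> \<le> norm (v - w) * (norm a * norm v) + norm w * (norm a * norm (v - w))"
    by (intro add_mono mult_left_mono \<pi>_contractive v vw norm_ge_zero)
  finally show ?thesis by (simp add: algebra_simps)
qed

text \<open>Normalised cyclic vectors approximate \<open>v\<close>, and their vector states are
  conjugates of \<open>\<omega>\<close>; norm-closedness of the folium gives the limit.\<close>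

lemma vector_state_in_folium:
  assumes v: "v \<in> H" and norm_v: "norm v = 1"
  shows "vector_state v \<in> S"
proof -
  have "vector_state v \<in> dual_space UNIV"
  proof -
    have "cmod (vector_state v a) \<le> 1 * norm a" for a
      using vector_state_diff[OF v subH(1), of a] norm_v by (simp add: vector_state_def)
    then show ?thesis
      unfolding dual_space_def
      by (auto simp: vector_state_def \<pi>_add v \<pi>_scaleC cinner_add_right cinner_scaleC_right
          intro!: exI[of _ 1])
  qed
  moreover have "\<exists>\<psi>\<in>S. functional_norm UNIV (\<lambda>a. vector_state v a - \<psi> a) < \<epsilon>" if "\<epsilon> > 0" for \<epsilon>
  proof -
    obtain b where b: "(\<lambda>n. \<pi> (b n) \<Omega>) \<longlonglongrightarrow> v" using cyclic_sequence[OF v] .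
    define c where "c n = complex_of_real (1 / norm (\<pi> (b n) \<Omega>))" for n
    define y where "y n = c n *\<^sub>C \<pi> (b n) \<Omega>" for n
    have y_scaleR: "y n = (1 / norm (\<pi> (b n) \<Omega>)) *\<^sub>R \<pi> (b n) \<Omega>" for n
      unfolding y_def c_def by (rule scaleC_of_real)
    have "y \<longlonglongrightarrow> (1 / norm v) *\<^sub>R v"
      unfolding y_scaleR using norm_v by (intro tendsto_intros b) simp
    then have y: "y \<longlonglongrightarrow> v" using norm_v by simp
    \<comment> \<open>Where \<open>\<pi> (b n) \<Omega>\<close> vanishes, \<open>c n\<close> is 0
      and \<open>y n\<close> is not a unit vector; such \<open>n\<close> are avoided.\<close>
    have "\<forall>\<^sub>F n in sequentially. norm (\<pi> (b n) \<Omega>) > 0"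
      using order_tendstoD(1)[OF tendsto_norm[OF b], of 0] norm_v by simp
    moreover have "\<forall>\<^sub>F n in sequentially. dist (y n) v < \<epsilon> / 3"
      using y that by (intro tendstoD) auto
    ultimately obtain n where n: "norm (\<pi> (b n) \<Omega>) > 0" "dist (y n) v < \<epsilon> / 3"
      using eventually_happens'[OF sequentially_bot eventually_conj] by blast
    have yn: "norm (y n) = 1" using n(1) by (simp add: y_scaleR)
    have mem: "y n \<in> H" unfolding y_def by (intro subH(3) \<pi>_mem \<Omega>)
    have y\<pi>: "y n = \<pi> (c n *\<^sub>C b n) \<Omega>" by (simp add: y_def \<pi>_scaleC \<Omega>)
    have "\<omega> (star (c n *\<^sub>C b n) * (c n *\<^sub>C b n)) = 1" unfolding \<omega>_norm y\<pi>[symmetric] yn by simp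
    then have "(\<lambda>a. \<omega> (star (c n *\<^sub>C b n) * a * (c n *\<^sub>C b n))) \<in> S"
      using S \<omega> unfolding folium_def by blast
    moreover have "(\<lambda>a. \<omega> (star (c n *\<^sub>C b n) * a * (c n *\<^sub>C b n))) = vector_state (y n)"
      unfolding \<omega>_conjugation y\<pi>[symmetric] vector_state_def ..
    ultimately have "vector_state (y n) \<in> S" by simp
    moreover have "functional_norm UNIV (\<lambda>a. vector_state v a - vector_state (y n) a) \<le> 2 * norm (v - y n)"
    proof (rule functional_norm_least)
      fix a :: 'f assume a: "norm a \<le> 1"
      have "cmod (vector_state v a - vector_state (y n) a) \<le> 2 * norm (v - y n) * norm a"
        using vector_state_diff[OF v mem, of a] norm_v yn by (simp add: algebra_simps)
      also have "\<dots> \<le> 2 * norm (v - y n) * 1" using a by (intro mult_left_mono) auto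
      finally show "cmod (vector_state v a - vector_state (y n) a) \<le> 2 * norm (v - y n)" by simp
    qed simp
    moreover have "2 * norm (v - y n) < \<epsilon>" using n(2) that by (simp add: dist_norm norm_minus_commute)
    ultimately show ?thesis by (meson order_le_less_trans)
  qed
  ultimately show ?thesis using S unfolding folium_def by blast
qed

text \<open>The vector \<open>v\<close> is \<open>sqrt (1 - A\<^sup>2) \<Omega>\<close>.\<close>

lemma vector_state_decomposition:
  assumes A: "selfadjoint_op H (1/2) A" and com: "\<And>a. commutes_on H A (\<pi> a)"
  shows "\<exists>v\<in>H. \<forall>a. \<omega> a = vector_state (A \<Omega>) a + vector_state v a"
proof -
  obtain y where y: "y \<in> H" "(\<lambda>n. sqrt_iter A n \<Omega>) \<longlonglongrightarrow> y"
    using sqrt_iter_converges[OF H A \<Omega>] by blast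
  note sa = selfadjoint_sqrt_iter[OF H(1) A]
  note lin = selfadjoint_opD(1)[OF sa]
  note ymem = linear_opD(1)[OF lin]
  note linA = selfadjoint_opD(1)[OF A]
  note Amem = linear_opD(1)[OF linA]
  have comy: "sqrt_iter A n (\<pi> a x) = \<pi> a (sqrt_iter A n x)" if "x \<in> H" for n a x
    using commutes_sqrt_iter[OF H(1) A linear_\<pi> com, of n a] that unfolding commutes_on_def by blast
  define v where "v n = \<Omega> - sqrt_iter A n \<Omega>" for n
  define d where "d n = sqrt_iter A (Suc n) \<Omega> - sqrt_iter A n \<Omega>" for n
  have vmem: "v n \<in> H" "d n \<in> H" for n unfolding v_def d_def by (intro subH(4) \<Omega> ymem)+
  have v_lim: "v \<longlonglongrightarrow> \<Omega> - y" unfolding v_def by (intro tendsto_intros y(2))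
  have "d \<longlonglongrightarrow> y - y" unfolding d_def by (intro tendsto_diff y(2) LIMSEQ_Suc)
  then have d_lim: "d \<longlonglongrightarrow> 0" by simp
  \<comment> \<open>Let \<open>?y\<close> be the n-th iterate. The recursion rewrites the square of
    \<open>1 - ?y\<close> as \<open>1 - A\<^sup>2\<close> plus twice the step to the next iterate;
    \<open>d n\<close> is this step at \<Omega> and tends to 0.\<close>
  have eq: "vector_state (v n) a = \<omega> a - vector_state (A \<Omega>) a + 2 * cinner \<Omega> (\<pi> a (d n))" for n a
  proof -
    let ?y = "sqrt_iter A n"
    have z: "sqrt_iter A (Suc n) \<Omega> = (1/2) *\<^sub>C (A (A \<Omega>) + ?y (?y \<Omega>))"
      by (rule fun_cong[OF sqrt_iter.simps(2)])
    have "2 *\<^sub>C sqrt_iter A (Suc n) \<Omega> = A (A \<Omega>) + ?y (?y \<Omega>)"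
      unfolding z scaleC_scaleC by simp
    moreover have two: "2 *\<^sub>C x = x + x" for x :: 'h using scaleC_add_left[of 1 1 x] by simp
    ultimately have sq: "v n - ?y (v n) = \<Omega> - A (A \<Omega>) + 2 *\<^sub>C d n"
      unfolding v_def d_def linear_opD(4)[OF lin \<Omega> H(1) ymem[OF \<Omega>]] scaleC_diff_right two
      by (simp add: algebra_simps)
    have "vector_state (v n) a = cinner \<Omega> (\<pi> a (v n)) - cinner (?y \<Omega>) (\<pi> a (v n))"
      unfolding vector_state_def by (simp add: v_def cinner_diff_left)
    \<comment> \<open>Selfadjointness moves the iterate to the right, where it passes through
      \<open>\<pi> a\<close>.\<close>
    also have "cinner (?y \<Omega>) (\<pi> a (v n)) = cinner \<Omega> (\<pi> a (?y (v n)))"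
      using selfadjoint_opD(3)[OF sa \<Omega> \<pi>_mem[OF vmem(1)]] comy[OF vmem(1)] by simp
    also have "cinner \<Omega> (\<pi> a (v n)) - \<dots> = cinner \<Omega> (\<pi> a (v n - ?y (v n)))"
      by (simp add: linear_opD(4)[OF linear_\<pi> vmem(1) H(1) ymem[OF vmem(1)]] cinner_diff_right)
    also have "\<dots> = cinner \<Omega> (\<pi> a \<Omega>) - cinner \<Omega> (\<pi> a (A (A \<Omega>))) + 2 * cinner \<Omega> (\<pi> a (d n))"
      unfolding sq
      using linear_opD(4)[OF linear_\<pi> \<Omega> H(1) Amem[OF Amem[OF \<Omega>]], of a]
        linear_opD(2)[OF linear_\<pi> subH(4)[OF \<Omega> Amem[OF Amem[OF \<Omega>]]] subH(3)[OF vmem(2)], of a]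
        linear_opD(3)[OF linear_\<pi> vmem(2), of a]
      by (simp add: cinner_add_right cinner_diff_right cinner_scaleC_right)
    also have "cinner \<Omega> (\<pi> a (A (A \<Omega>))) = vector_state (A \<Omega>) a"
      using com[of a] selfadjoint_opD(3)[OF A \<Omega> \<pi>_mem[OF Amem[OF \<Omega>]], of a] Amem[OF \<Omega>]
      unfolding vector_state_def commutes_on_def by simp
    finally show ?thesis by (simp add: \<omega>_eq)
  qed
  have vy: "\<Omega> - y \<in> H" using subH(4)[OF \<Omega> y(1)] .
  have "vector_state (\<Omega> - y) a = \<omega> a - vector_state (A \<Omega>) a" for a
  proof (rule LIMSEQ_unique)
    show "(\<lambda>n. vector_state (v n) a) \<longlonglongrightarrow> vector_state (\<Omega> - y) a"
      unfolding vector_state_def by (intro tendsto_cinner v_lim \<pi>_tendsto vmem vy)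
    have "(\<lambda>n. cinner \<Omega> (\<pi> a (d n))) \<longlonglongrightarrow> cinner \<Omega> (\<pi> a 0)"
      by (intro tendsto_cinner tendsto_const \<pi>_tendsto d_lim subH(1) vmem)
    moreover have "\<pi> a 0 = 0" using linear_opD(3)[OF linear_\<pi> subH(1), of a 0] by simp
    ultimately have "(\<lambda>n. \<omega> a - vector_state (A \<Omega>) a + 2 * cinner \<Omega> (\<pi> a (d n)))
        \<longlonglongrightarrow> \<omega> a - vector_state (A \<Omega>) a + 2 * 0"
      by (intro tendsto_intros) simp
    then show "(\<lambda>n. vector_state (v n) a) \<longlonglongrightarrow> \<omega> a - vector_state (A \<Omega>) a" by (simp add: eq)
  qed
  then show ?thesis using vy by (intro bexI[of _ "\<Omega> - y"]) auto
qed

section \<open>Extremality and the commutant\<close>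

text \<open>Extremality makes the vector functional of \<open>A \<Omega>\<close> equal to
  \<open>t\<close> times \<open>\<omega>\<close>. Evaluated at \<open>star c * b\<close>, this
  compares the matrix elements of the square of \<open>A\<close> and of the scalar \<open>t\<close>
  between cyclic vectors.\<close>

lemma selfadjoint_sq_scalar:
  assumes ex: "extremal_in S \<omega>"
    and A: "selfadjoint_op H (1/2) A" and com: "\<And>a. commutes_on H A (\<pi> a)"
  shows "\<exists>t. \<forall>x\<in>H. A (A x) = t *\<^sub>C x"
proof -
  note linA = selfadjoint_opD(1)[OF A]
  note Amem = linear_opD(1)[OF linA]
  have u: "A \<Omega> \<in> H" using Amem[OF \<Omega>] .
  obtain v where v: "v \<in> H" "\<And>a. \<omega> a = vector_state (A \<Omega>) a + vector_state v a"
    using vector_state_decomposition[OF A com] by blast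
  define t where "t = (norm (A \<Omega>))\<^sup>2"
  \<comment> \<open>The bound keeps \<open>t\<close> below 1, so \<open>v\<close> is nonzero and can
    be normalised.\<close>
  have "norm (A \<Omega>) \<le> 1/2" using selfadjoint_opD(2)[OF A \<Omega>] norm_\<Omega> by simp
  then have "t \<le> (1/2)\<^sup>2" unfolding t_def by (intro power_mono) auto
  then have t: "0 \<le> t" "t < 1" by (simp_all add: t_def power2_eq_square)
  have "complex_of_real 1 = of_real (t + (norm v)\<^sup>2)"
    using v(2)[of 1] vector_state_one[OF u] vector_state_one[OF v(1)] state_at_one[OF state]
    by (simp add: t_def)
  then have norm_v: "(norm v)\<^sup>2 = 1 - t" unfolding of_real_eq_iff by simp
  have unit: "vector_state (complex_of_real (1 / norm w) *\<^sub>C w) \<in> S"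
    and unit_eq: "vector_state w a =
      of_real ((norm w)\<^sup>2) * vector_state (complex_of_real (1 / norm w) *\<^sub>C w) a"
    if w: "w \<in> H" "w \<noteq> 0" for w a
  proof -
    show "vector_state (complex_of_real (1 / norm w) *\<^sub>C w) \<in> S"
      using w by (intro vector_state_in_folium subH(3)) (simp_all add: norm_scaleC norm_divide)
    show "vector_state w a =
      of_real ((norm w)\<^sup>2) * vector_state (complex_of_real (1 / norm w) *\<^sub>C w) a"
      unfolding vector_state_scaleC[OF w(1)] using w(2) by (simp add: norm_divide power_divide)
  qed
  have vs: "vector_state (A \<Omega>) a = of_real t * \<omega> a" for a
  proof (cases "t = 0")
    case True
    then have "A \<Omega> = 0" by (simp add: t_def)
    then show ?thesis using True by (simp add: vector_state_def)
  next
    case False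
    define \<phi> \<psi> where "\<phi> = vector_state (complex_of_real (1 / norm (A \<Omega>)) *\<^sub>C A \<Omega>)"
      and "\<psi> = vector_state (complex_of_real (1 / norm v) *\<^sub>C v)"
    have nz: "A \<Omega> \<noteq> 0" "v \<noteq> 0" using False norm_v t(2) by (auto simp: t_def)
    have mem: "\<phi> \<in> S" "\<psi> \<in> S" unfolding \<phi>_def \<psi>_def using unit u v(1) nz by blast+
    have "\<omega> = mix t \<phi> \<psi>"
      unfolding mix_def \<phi>_def \<psi>_def t_def[symmetric]
      using v(2) unit_eq[OF u nz(1)] unit_eq[OF v(1) nz(2)] norm_v
      by (intro ext) (simp only: t_def)
    then have "\<phi> = \<omega>" using ex mem t False unfolding extremal_in_def by auto
    then show ?thesis using unit_eq[OF u nz(1), of a] by (simp only: \<phi>_def t_def)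
  qed
  have orth: "A (A (\<pi> b \<Omega>)) = of_real t *\<^sub>C \<pi> b \<Omega>" for b
  proof -
    have b: "\<pi> b \<Omega> \<in> H" using \<pi>_mem[OF \<Omega>] .
    have "A (A (\<pi> b \<Omega>)) - of_real t *\<^sub>C \<pi> b \<Omega> = 0"
    proof (rule cyclic_orthogonal)
      show "A (A (\<pi> b \<Omega>)) - of_real t *\<^sub>C \<pi> b \<Omega> \<in> H" using b by (intro subH(3,4) Amem)
      fix c
      have c: "\<pi> c \<Omega> \<in> H" using \<pi>_mem[OF \<Omega>] .
      have pull: "A (\<pi> x \<Omega>) = \<pi> x (A \<Omega>)" for x
        using com[of x] \<Omega> unfolding commutes_on_def by blast
      have move: "cinner (\<pi> c x) (\<pi> b y) = cinner x (\<pi> (star c * b) y)" if "x \<in> H" "y \<in> H" for x y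
        using \<pi>_adjoint[OF that(1) \<pi>_mem[OF that(2)], of "star c" b] \<pi>_mult[OF that(2)]
        by (simp add: star_star)
      have "cinner (\<pi> c \<Omega>) (A (A (\<pi> b \<Omega>))) = cinner (A (\<pi> c \<Omega>)) (A (\<pi> b \<Omega>))"
        using selfadjoint_opD(3)[OF A c Amem[OF b]] by simp
      also have "\<dots> = vector_state (A \<Omega>) (star c * b)"
        unfolding pull move[OF u u] vector_state_def ..
      also have "\<dots> = of_real t * cinner (\<pi> c \<Omega>) (\<pi> b \<Omega>)"
        unfolding vs move[OF \<Omega> \<Omega>] \<omega>_eq ..
      finally show "cinner (\<pi> c \<Omega>) (A (A (\<pi> b \<Omega>)) - of_real t *\<^sub>C \<pi> b \<Omega>) = 0"
        by (simp add: cinner_diff_right cinner_scaleC_right)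
    qed
    then show ?thesis by simp
  qed
  \<comment> \<open>The identity extends from cyclic vectors to \<open>H\<close> by moving both
    factors \<open>A\<close> onto the cyclic vector.\<close>
  have "A (A x) = of_real t *\<^sub>C x" if x: "x \<in> H" for x
  proof -
    have "A (A x) - of_real t *\<^sub>C x = 0"
    proof (rule cyclic_orthogonal)
      show "A (A x) - of_real t *\<^sub>C x \<in> H" using x by (intro subH(3,4) Amem)
      fix b
      have b: "\<pi> b \<Omega> \<in> H" using \<pi>_mem[OF \<Omega>] .
      have "cinner (\<pi> b \<Omega>) (A (A x)) = cinner (A (A (\<pi> b \<Omega>))) x"
        using selfadjoint_opD(3)[OF A b Amem[OF x]] selfadjoint_opD(3)[OF A Amem[OF b] x] by simp
      then show "cinner (\<pi> b \<Omega>) (A (A x) - of_real t *\<^sub>C x) = 0"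
        by (simp add: orth cinner_diff_right cinner_scaleC_right cinner_scaleC_left)
    qed
    then show ?thesis by simp
  qed
  then show ?thesis by blast
qed

text \<open>If \<open>B\<^sup>2\<close> and \<open>(B + 1/4)\<^sup>2\<close> are scalar, then so is \<open>B\<close>.\<close>

lemma selfadjoint_scalar:
  assumes ex: "extremal_in S \<omega>"
    and A: "selfadjoint_op H K A" and com: "\<And>a. commutes_on H A (\<pi> a)"
  shows "\<exists>c. \<forall>x\<in>H. A x = c *\<^sub>C x"
proof -
  define M where "M = max K 1"
  have M: "M > 0" "K \<le> M" by (simp_all add: M_def)
  \<comment> \<open>The scaling gives \<open>B\<close> the bound 1/4, which leaves room for adding
    1/4 within the bound 1/2.\<close>
  define s where "s = complex_of_real (1 / (4 * M))"
  have s: "s \<noteq> 0" "cnj s = s" "cmod s = 1 / (4 * M)"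
    using M by (simp_all add: s_def norm_divide norm_mult)
  define B where "B x = s *\<^sub>C A x" for x
  define D where "D x = B x + (1/4) *\<^sub>C x" for x
  note linA = linear_opD[OF selfadjoint_opD(1)[OF A]]
  have linB: "linear_op H B"
    unfolding linear_op_def B_def
    by (simp add: linA subH scaleC_add_right scaleC_scaleC mult.commute)
  note lB = linear_opD[OF linB]
  have linD: "linear_op H D"
    unfolding linear_op_def D_def
    by (simp add: lB subH scaleC_add_right scaleC_scaleC mult.commute add_ac)
  have nB: "norm (B x) \<le> 1/4 * norm x" if "x \<in> H" for x
  proof -
    have "norm (A x) \<le> M * norm x"
      using selfadjoint_opD(2)[OF A that] mult_right_mono[OF M(2) norm_ge_zero[of x]] by linarith
    then show ?thesis using M(1) by (simp add: B_def norm_scaleC s(3) field_simps)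
  qed
  have saB: "cinner (B x) y = cinner x (B y)" if "x \<in> H" "y \<in> H" for x y
    using selfadjoint_opD(3)[OF A that] by (simp add: B_def cinner_scaleC_left cinner_scaleC_right s(2))
  have B: "selfadjoint_op H (1/2) B"
    unfolding selfadjoint_op_def
  proof (intro conjI ballI)
    fix x assume x: "x \<in> H"
    show "norm (B x) \<le> 1/2 * norm x" using nB[OF x] norm_ge_zero[of x] by linarith
  qed (use linB saB in auto)
  have D: "selfadjoint_op H (1/2) D"
    unfolding selfadjoint_op_def
  proof (intro conjI ballI)
    fix x y assume x: "x \<in> H" and y: "y \<in> H"
    have "norm (D x) \<le> norm (B x) + 1/4 * norm x"
      unfolding D_def using norm_triangle_ineq[of "B x" "(1/4) *\<^sub>C x"] by (simp add: norm_scaleC norm_divide)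
    then show "norm (D x) \<le> 1/2 * norm x" using nB[OF x] by linarith
    show "cinner (D x) y = cinner x (D y)"
      using saB[OF x y]
      by (simp add: D_def cinner_add_left cinner_add_right cinner_scaleC_left cinner_scaleC_right)
  qed (rule linD)
  have comB: "commutes_on H B (\<pi> a)" for a
    using com[of a] linear_opD(3)[OF linear_\<pi>] linA(1) by (simp add: commutes_on_def B_def)
  have comD: "commutes_on H D (\<pi> a)" for a
    using comB[of a] linear_opD(2,3)[OF linear_\<pi>] lB(1) subH(3)
    by (simp add: commutes_on_def D_def)
  obtain p where p: "\<forall>x\<in>H. B (B x) = p *\<^sub>C x" using selfadjoint_sq_scalar[OF ex B comB] by blast
  obtain q where q: "\<forall>x\<in>H. D (D x) = q *\<^sub>C x" using selfadjoint_sq_scalar[OF ex D comD] by blast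
  \<comment> \<open>The square of \<open>D\<close> minus the square of \<open>B\<close> is half of
    \<open>B\<close> plus 1/16; solving for \<open>B\<close> and undoing the factor \<open>s\<close>
    gives this scalar.\<close>
  have "A x = ((q - p - 1/16) * 2 / s) *\<^sub>C x" if x: "x \<in> H" for x
  proof -
    have "D (D x) = B (B x) + (1/4) *\<^sub>C B x + ((1/4) *\<^sub>C B x + (1/16) *\<^sub>C x)"
      using lB(1)[OF x] subH(3)[OF x]
      by (simp add: D_def lB(2,3) x scaleC_add_right scaleC_scaleC)
    also have "\<dots> = B (B x) + ((1/4 + 1/4) *\<^sub>C B x + (1/16) *\<^sub>C x)"
      unfolding scaleC_add_left by (simp add: add_ac)
    finally have "q *\<^sub>C x = p *\<^sub>C x + ((1/2) *\<^sub>C B x + (1/16) *\<^sub>C x)"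
      unfolding bspec[OF p x] bspec[OF q x] by simp
    then have "(1/2) *\<^sub>C B x = q *\<^sub>C x - p *\<^sub>C x - (1/16) *\<^sub>C x" by simp
    then have half: "(1/2) *\<^sub>C B x = (q - p - 1/16) *\<^sub>C x" by (simp only: scaleC_diff_left)
    have "A x = (2 / s) *\<^sub>C ((1/2) *\<^sub>C B x)" using s(1) by (simp add: B_def scaleC_scaleC)
    then show ?thesis unfolding half scaleC_scaleC by (simp add: mult.commute)
  qed
  then show ?thesis by blast
qed

text \<open>The adjoint \<open>T'\<close> splits \<open>T\<close> into real and imaginary parts,
  which are selfadjoint and commute with \<pi>, so each is scalar.\<close>

lemma commutant_scalar:
  assumes ex: "extremal_in S \<omega>"
    and T: "T \<in> commutant H (range \<pi>)" and T': "T' \<in> commutant H (range \<pi>)"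
    and adj: "adjoint_on H T T'"
  shows "\<exists>c. \<forall>x\<in>H. T x = c *\<^sub>C x"
proof -
  have lin: "linear_op H T" "linear_op H T'" and com: "commutes_on H T (\<pi> a)" "commutes_on H T' (\<pi> a)" for a
    using T T' by (auto simp: commutant_def bounded_operators_def linear_op_def commutes_on_def)
  obtain K K' where K: "\<forall>x\<in>H. norm (T x) \<le> K * norm x" "\<forall>x\<in>H. norm (T' x) \<le> K' * norm x"
    using T T' by (auto simp: commutant_def bounded_operators_def)
  note l = linear_opD[OF lin(1)] linear_opD[OF lin(2)]
  have adj1: "cinner (T' x) y = cinner x (T y)" if "x \<in> H" "y \<in> H" for x y
    using adj that by (simp add: adjoint_on_def)
  have adj2: "cinner (T x) y = cinner x (T' y)" if "x \<in> H" "y \<in> H" for x y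
    using adj1[OF that(2,1)] by (metis cinner_commute)
  \<comment> \<open>\<alpha> equal to 1/2 gives the real part, and \<alpha> equal to
    \<open>- \<i>/2\<close> the imaginary part.\<close>
  have scalar: "\<exists>c. \<forall>x\<in>H. \<alpha> *\<^sub>C T x + cnj \<alpha> *\<^sub>C T' x = c *\<^sub>C x" for \<alpha>
  proof (rule selfadjoint_scalar[OF ex])
    let ?A = "\<lambda>x. \<alpha> *\<^sub>C T x + cnj \<alpha> *\<^sub>C T' x"
    show "selfadjoint_op H (cmod \<alpha> * K + cmod \<alpha> * K') ?A"
      unfolding selfadjoint_op_def
    proof (intro conjI ballI)
      show "linear_op H ?A"
        unfolding linear_op_def
        by (simp add: l subH scaleC_add_right scaleC_scaleC mult.commute add_ac)
      fix x y assume x: "x \<in> H" and y: "y \<in> H"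
      have "norm (?A x) \<le> cmod \<alpha> * norm (T x) + cmod \<alpha> * norm (T' x)"
        using norm_triangle_ineq[of "\<alpha> *\<^sub>C T x" "cnj \<alpha> *\<^sub>C T' x"] by (simp add: norm_scaleC)
      also have "\<dots> \<le> cmod \<alpha> * (K * norm x) + cmod \<alpha> * (K' * norm x)"
        using K x by (intro add_mono mult_left_mono) auto
      finally show "norm (?A x) \<le> (cmod \<alpha> * K + cmod \<alpha> * K') * norm x" by (simp add: algebra_simps)
      show "cinner (?A x) y = cinner x (?A y)"
        using adj1[OF x y] adj2[OF x y]
        by (simp add: cinner_add_left cinner_add_right cinner_scaleC_left cinner_scaleC_right)
    qed
    show "commutes_on H ?A (\<pi> a)" for a
      using com[of a] linear_opD(2,3)[OF linear_\<pi>] l(1,5) subH(3)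
      by (simp add: commutes_on_def)
  qed
  obtain c where c: "\<forall>x\<in>H. (1/2) *\<^sub>C T x + cnj (1/2) *\<^sub>C T' x = c *\<^sub>C x" using scalar by blast
  obtain d where d: "\<forall>x\<in>H. (- \<i>/2) *\<^sub>C T x + cnj (- \<i>/2) *\<^sub>C T' x = d *\<^sub>C x" using scalar by blast
  have "T x = (c + \<i> * d) *\<^sub>C x" if x: "x \<in> H" for x
  proof -
    have "(c + \<i> * d) *\<^sub>C x = c *\<^sub>C x + \<i> *\<^sub>C (d *\<^sub>C x)" by (simp add: scaleC_add_left scaleC_scaleC)
    also have "\<dots> = ((1/2) *\<^sub>C T x + (1/2) *\<^sub>C T' x) + ((1/2) *\<^sub>C T x + (- 1/2) *\<^sub>C T' x)"
      unfolding bspec[OF c x, symmetric] bspec[OF d x, symmetric]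
      by (simp add: scaleC_add_right scaleC_scaleC)
    also have "\<dots> = (1/2 + 1/2) *\<^sub>C T x + (1/2 + - 1/2) *\<^sub>C T' x"
      unfolding scaleC_add_left by (simp add: algebra_simps)
    finally show ?thesis by simp
  qed
  then show ?thesis by blast
qed

end

section \<open>The discrete point\<close>

text \<open>Composing with \<open>R\<close> is multiplying by \<open>f R\<close>, so
  multiplicativity and homogeneity of \<open>\<psi>\<close> both compute the value at the product.
  An operator \<open>T\<close> with \<open>\<psi> T\<close> nonzero plays the part of the unit and
  can be cancelled.\<close>

lemma gelfand_spectrum_scalar:
  assumes scalar: "\<And>T x. T \<in> C \<Longrightarrow> x \<in> H \<Longrightarrow> T x = f T *\<^sub>C x"
    and C: "C \<subseteq> bounded_operators H" and \<psi>: "\<psi> \<in> gelfand_spectrum H C"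
  shows "\<psi> = restrict f C"
proof
  have D: "\<psi> \<in> extensional C" "\<forall>c. \<forall>T\<in>C. \<psi> (\<lambda>x\<in>H. c *\<^sub>C T x) = c * \<psi> T"
    "\<forall>S\<in>C. \<forall>T\<in>C. \<psi> (\<lambda>x\<in>H. S (T x)) = \<psi> S * \<psi> T" "\<exists>T\<in>C. \<psi> T \<noteq> 0"
    using \<psi> unfolding gelfand_spectrum_def mem_Collect_eq by - (elim conjE; assumption)+
  then obtain T where T: "T \<in> C" "\<psi> T \<noteq> 0" by blast
  have mem: "T x \<in> H" if "x \<in> H" for x
    using subsetD[OF C T(1)] that unfolding bounded_operators_def by (simp add: PiE_iff)
  fix R
  show "\<psi> R = restrict f C R"
  proof (cases "R \<in> C")
    case True
    have eq: "(\<lambda>x\<in>H. R (T x)) = (\<lambda>x\<in>H. f R *\<^sub>C T x)"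
      by (rule restrict_ext) (rule scalar[OF True mem])
    have "\<psi> R * \<psi> T = \<psi> (\<lambda>x\<in>H. R (T x))"
      by (rule bspec[OF bspec[OF D(3) True] T(1), symmetric])
    also have "\<dots> = f R * \<psi> T"
      unfolding eq by (rule bspec[OF spec[OF D(2)] T(1)])
    finally have "\<psi> R * \<psi> T = f R * \<psi> T" .
    then have "\<psi> R = f R" using T(2) by (simp only: mult_cancel_right) simp
    then show ?thesis using True by simp
  next
    case False
    then show ?thesis using extensional_arb[OF D(1) False] by simp
  qed
qed

theorem theorem2p13:
  fixes S\<^sub>0 :: "('f::cstar_algebra_1 \<Rightarrow> complex) set"
    and H :: "('f \<Rightarrow> complex) \<Rightarrow> 'h::chilbert_space set"
    and \<pi> :: "('f \<Rightarrow> complex) \<Rightarrow> 'f \<Rightarrow> 'h \<Rightarrow> 'h"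
    and \<Omega> :: "('f \<Rightarrow> complex) \<Rightarrow> 'h"
    and C :: "('f \<Rightarrow> complex) \<Rightarrow> ('h \<Rightarrow> 'h) set"
    and \<mu> :: "('f \<Rightarrow> complex) \<Rightarrow> (('h \<Rightarrow> 'h) \<Rightarrow> complex) measure"
    and L :: "'e::cstar_algebra_1 set"
  assumes "folium S\<^sub>0" and "S\<^sub>0 \<subset> state_space UNIV"
    and "\<And>\<omega>. \<omega> \<in> S\<^sub>0 \<Longrightarrow> gns_representation \<omega> (H \<omega>) (\<pi> \<omega>) (\<Omega> \<omega>)"
    and "\<And>\<omega>. \<omega> \<in> S\<^sub>0 \<Longrightarrow>
           maximally_commutative_subalgebra (H \<omega>) (commutant (H \<omega>) (range (\<pi> \<omega>))) (C \<omega>)"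
    and "\<And>\<omega>. \<omega> \<in> S\<^sub>0 \<Longrightarrow> gelfand_measure (H \<omega>) (C \<omega>) (\<Omega> \<omega>) (\<mu> \<omega>)"
    and "ideal_host L S\<^sub>0"
  shows "discrete_points (disjoint_union_measure S\<^sub>0 \<mu>) \<noteq> {}"
proof -
  have "S\<^sub>0 \<noteq> {}" "S\<^sub>0 \<subseteq> state_space UNIV" using assms(1) by (auto simp: folium_def)
  then obtain \<omega> where ex: "extremal_in S\<^sub>0 \<omega>" using ideal_host_extremal_state assms(6) by blast
  then have \<omega>: "\<omega> \<in> S\<^sub>0" by (simp add: extremal_in_def)
  interpret gns_folium S\<^sub>0 \<omega> "H \<omega>" "\<pi> \<omega>" "\<Omega> \<omega>"
    using assms(1) \<omega> assms(3)[OF \<omega>] by unfold_locales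
  have C: "C \<omega> \<subseteq> commutant (H \<omega>) (range (\<pi> \<omega>))" "C \<omega> \<subseteq> bounded_operators (H \<omega>)"
    "\<forall>T\<in>C \<omega>. \<exists>T'\<in>C \<omega>. adjoint_on (H \<omega>) T T'"
    using assms(4)[OF \<omega>]
    by (simp_all add: maximally_commutative_subalgebra_def von_neumann_algebra_def)
  have "\<forall>T\<in>C \<omega>. \<exists>c. \<forall>x\<in>H \<omega>. T x = c *\<^sub>C x"
  proof
    fix T assume T: "T \<in> C \<omega>"
    then obtain T' where T': "T' \<in> C \<omega>" "adjoint_on (H \<omega>) T T'" using C(3) by blast
    show "\<exists>c. \<forall>x\<in>H \<omega>. T x = c *\<^sub>C x"
      by (rule commutant_scalar[OF ex subsetD[OF C(1) T] subsetD[OF C(1) T'(1)] T'(2)])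
  qed
  then obtain f where "\<forall>T\<in>C \<omega>. \<forall>x\<in>H \<omega>. T x = f T *\<^sub>C x" by metis
  then have point: "\<psi> = restrict f (C \<omega>)" if "\<psi> \<in> gelfand_spectrum (H \<omega>) (C \<omega>)" for \<psi>
    using gelfand_spectrum_scalar[OF _ C(2) that, of f] by simp
  have M: "prob_space (\<mu> \<omega>)" "space (\<mu> \<omega>) = gelfand_spectrum (H \<omega>) (C \<omega>)"
    using assms(5)[OF \<omega>] by (simp_all add: gelfand_measure_def)
  define \<psi> where "\<psi> = restrict f (C \<omega>)"
  have space: "space (\<mu> \<omega>) = {\<psi>}"
  proof -
    \<comment> \<open>Existence of a character is read off from the probability measure carried by
      the spectrum.\<close>
    have "space (\<mu> \<omega>) \<noteq> {}" by (rule prob_space.not_empty[OF M(1)])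
    moreover have "space (\<mu> \<omega>) \<subseteq> {\<psi>}"
    proof
      fix x assume "x \<in> space (\<mu> \<omega>)"
      then show "x \<in> {\<psi>}" unfolding M(2) \<psi>_def singleton_iff by (rule point)
    qed
    ultimately show ?thesis by (simp add: subset_singleton_iff)
  qed
  let ?M = "disjoint_union_measure S\<^sub>0 \<mu>"
  have preimage: "Pair i -` {(\<omega>, \<psi>)} = (if i = \<omega> then {\<psi>} else {})" for i by auto
  have "{\<psi>} \<in> sets (\<mu> \<omega>)" using sets.top[of "\<mu> \<omega>"] by (simp add: space)
  then have sets: "{(\<omega>, \<psi>)} \<in> sets ?M"
    using \<omega> space by (auto simp: sets_disjoint_union_measure preimage)
  have "1 = emeasure (\<mu> \<omega>) (Pair \<omega> -` {(\<omega>, \<psi>)})"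
    using prob_space.emeasure_space_1[OF M(1)] by (simp add: preimage space)
  \<comment> \<open>The integral over the counting measure dominates its term at
    \<open>\<omega>\<close>, which is 1.\<close>
  also have "\<dots> \<le> (\<integral>\<^sup>+i. emeasure (\<mu> i) (Pair i -` {(\<omega>, \<psi>)}) \<partial>count_space S\<^sub>0)"
    using \<omega> by (rule nn_integral_ge_point)
  also have "\<dots> = emeasure ?M {(\<omega>, \<psi>)}" by (rule emeasure_disjoint_union_measure[OF sets, symmetric])
  finally have "emeasure ?M {(\<omega>, \<psi>)} > 0" by (rule less_le_trans[OF zero_less_one])
  moreover have "(\<omega>, \<psi>) \<in> space ?M" using \<omega> space by (simp add: space_disjoint_union_measure)
  ultimately have "(\<omega>, \<psi>) \<in> discrete_points ?M" by (simp add: discrete_points_def)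
  then show ?thesis by auto
qed

end
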